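(* Let $K$ be the ground field, let $\mathbf R=\operatorname{Lie}(v_0,v_1)$, and consider the weight $\mathbb N$-gradation $\mathbf R=\bigoplus_{n=1}^\infty\tilde{\mathbf R}_n$, where $\tilde{\mathbf R}_n$ is the span of all $w\in\mathbf R_{n_1,n_2}$ with $n_1+2n_2=n$. Then $\dim\tilde{\mathbf R}_n=2$ for $n\ge 1$, except $\dim\tilde{\mathbf R}_1=\dim\tilde{\mathbf R}_3=1$.
   Context: The ground field $K$ is arbitrary. Let $\Lambda=\Lambda(x_i\mid i\ge 0)$ be the Grassmann algebra over $K$ on odd generators $x_0,x_1,\dots$, a $\mathbb Z_2$-graded algebra. In $\operatorname{End}\Lambda$ identify $x_i$ with left multiplication by $x_i$, and let $\partial_i$ be the odd superderivation of $\Lambda$ with $\partial_i(x_j)=\delta_{ij}$. The supercommutator is $[a,b]=ab-(-1)^{\deg a\deg b}ba$. The pivot elements are the odd superderivations $v_i=\partial_i+x_ix_{i+1}(\partial_{i+2}+x_{i+2}x_{i+3}(\partial_{i+4}+\cdots))$, $i\ge 0$, that is, $v_i=\partial_i+x_ix_{i+1}v_{i+2}$ (well defined on $\Lambda$, since each element of $\Lambda$ involves finitely many letters). $\mathbf R=\operatorname{Lie}(v_0,v_1)$ is the Lie superalgebra generated by $v_0,v_1$ inside the superderivations of $\Lambda$: it is closed under the supercommutator and, in case $\operatorname{char}K=2$, also under the quadratic mapping $a\mapsto a^2$ on odd elements (the square being taken in $\operatorname{End}\Lambda$). It is $\mathbb Z^2$-graded by multidegree in the generators, $\mathbf R=\bigoplus_{n_1,n_2\ge0}\mathbf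 R_{n_1,n_2}$, with $\mathbf R_{n_1,n_2}$ spanned by all Lie elements of multidegree $(n_1,n_2)$ in $\{v_0,v_1\}$. The number $n_1+2n_2$ is the weight of elements of $\mathbf R_{n_1,n_2}$ (so $v_0$ has weight $1$ and $v_1$ has weight $2$).
   Formalization: The dimension formula is stated only for char K ≠ 2 (the weight gradation for every K); in char K = 2 it fails, since the weight 5 component is spanned by x_0x_1v_3 alone, [v_0,v_2] = 2x_0x_1x_3v_4 being zero. *)

theory Defs
  imports Complex_Main "HOL-Library.Function_Algebras"
begin

section \<open>The Grassmann algebra on countably many generators\<close>

text \<open>
  An element of the Grassmann algebra is its coefficient function: the coefficient at a finite
  set \<open>S = {i1 < \<dots> < in}\<close> belongs to the monomial \<open>x_i1 \<cdots> x_in\<close>.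
\<close>

typedef (overloaded) 'k grassmann =
  "{f :: nat set \<Rightarrow> 'k::zero. finite {S. f S \<noteq> 0} \<and> (\<forall>S. f S \<noteq> 0 \<longrightarrow> finite S)}"
  morphisms coeff Abs_grassmann
  by (rule exI[of _ "\<lambda>_. 0"]) auto

setup_lifting type_definition_grassmann

text \<open>
  \<open>x_A x_B = inv_sign A B x_(A \<union> B)\<close> for disjoint \<open>A\<close>, \<open>B\<close>.
\<close>

definition inv_sign :: "nat set \<Rightarrow> nat set \<Rightarrow> 'k::comm_ring_1" where
  "inv_sign A B = (-1) ^ card {(a, b). a \<in> A \<and> b \<in> B \<and> b < a}"

lemma finite_coeff_support: "finite {S. coeff f S \<noteq> 0}"
  using coeff[of f] by simp

lemma coeff_infinite: "infinite S \<Longrightarrow> coeff f S = 0"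
  using coeff[of f] by auto

lemma grassmann_eqI: "(\<And>S. finite S \<Longrightarrow> coeff f S = coeff g S) \<Longrightarrow> f = g"
  by (metis coeff_infinite coeff_inject ext)

instantiation grassmann :: (comm_ring_1) ring_1
begin

lift_definition zero_grassmann :: "'a grassmann" is "\<lambda>_. 0" by simp

lift_definition one_grassmann :: "'a grassmann" is "\<lambda>S. if S = {} then 1 else 0" by auto

lift_definition plus_grassmann :: "'a grassmann \<Rightarrow> 'a grassmann \<Rightarrow> 'a grassmann"
  is "\<lambda>f g S. f S + g S"
proof -
  fix f g :: "nat set \<Rightarrow> 'a"
  assume f: "finite {S. f S \<noteq> 0} \<and> (\<forall>S. f S \<noteq> 0 \<longrightarrow> finite S)"
    and g: "finite {S. g S \<noteq> 0} \<and> (\<forall>S. g S \<noteq> 0 \<longrightarrow> finite S)"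
  have "finite ({S. f S \<noteq> 0} \<union> {S. g S \<noteq> 0})"
    and "\<forall>S. f S + g S \<noteq> 0 \<longrightarrow> finite S" using f g by (auto, metis add_0)
  moreover have "{S. f S + g S \<noteq> 0} \<subseteq> {S. f S \<noteq> 0} \<union> {S. g S \<noteq> 0}" by auto
  ultimately show "finite {S. f S + g S \<noteq> 0} \<and> (\<forall>S. f S + g S \<noteq> 0 \<longrightarrow> finite S)"
    using finite_subset by blast
qed

lift_definition uminus_grassmann :: "'a grassmann \<Rightarrow> 'a grassmann" is "\<lambda>f S. - f S" by simp

definition minus_grassmann :: "'a grassmann \<Rightarrow> 'a grassmann \<Rightarrow> 'a grassmann" where
  "minus_grassmann f g = f + - g"

lift_definition times_grassmann :: "'a grassmann \<Rightarrow> 'a grassmann \<Rightarrow> 'a grassmann"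
  is "\<lambda>f g S. if finite S then \<Sum>A\<in>Pow S. inv_sign A (S - A) * f A * g (S - A) else 0"
proof -
  fix f g :: "nat set \<Rightarrow> 'a"
  let ?h = "\<lambda>S. if finite S then \<Sum>A\<in>Pow S. inv_sign A (S - A) * f A * g (S - A) else 0"
  assume f: "finite {S. f S \<noteq> 0} \<and> (\<forall>S. f S \<noteq> 0 \<longrightarrow> finite S)"
    and g: "finite {S. g S \<noteq> 0} \<and> (\<forall>S. g S \<noteq> 0 \<longrightarrow> finite S)"
  have "{S. ?h S \<noteq> 0} \<subseteq> (\<lambda>(A, B). A \<union> B) ` ({S. f S \<noteq> 0} \<times> {S. g S \<noteq> 0})"
  proof
    fix S assume "S \<in> {S. ?h S \<noteq> 0}"
    then have "(\<Sum>A\<in>Pow S. inv_sign A (S - A) * f A * g (S - A)) \<noteq> 0"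
      by (auto split: if_splits)
    then obtain A where A: "A \<in> Pow S" "inv_sign A (S - A) * f A * g (S - A) \<noteq> 0"
      by (meson sum.neutral)
    then have "(A, S - A) \<in> {S. f S \<noteq> 0} \<times> {S. g S \<noteq> 0}" "A \<union> (S - A) = S" by auto
    then show "S \<in> (\<lambda>(A, B). A \<union> B) ` ({S. f S \<noteq> 0} \<times> {S. g S \<noteq> 0})"
      by (metis (mono_tags, lifting) case_prod_conv image_eqI)
  qed
  then have "finite {S. ?h S \<noteq> 0}" using f g by (meson finite_SigmaI finite_imageI finite_subset)
  then show "finite {S. ?h S \<noteq> 0} \<and> (\<forall>S. ?h S \<noteq> 0 \<longrightarrow> finite S)" by auto
qed

lemma coeff_mult: "finite S \<Longrightarrow>
    coeff (f * g) S = (\<Sum>A\<in>Pow S. inv_sign A (S - A) * coeff f A * coeff g (S - A))"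
  by (simp add: times_grassmann.rep_eq)

lemmas coeff_simps = zero_grassmann.rep_eq one_grassmann.rep_eq plus_grassmann.rep_eq
  uminus_grassmann.rep_eq

lemma inv_sign_empty [simp]: "inv_sign {} B = 1" "inv_sign A {} = 1"
  by (auto simp: inv_sign_def)

lemma inv_sign_un_left:
  assumes "finite A" "finite B" "finite C" "A \<inter> B = {}"
  shows "inv_sign (A \<union> B) C = (inv_sign A C * inv_sign B C :: 'a)"
proof -
  have "{(a, b). a \<in> A \<union> B \<and> b \<in> C \<and> b < a} =
     {(a, b). a \<in> A \<and> b \<in> C \<and> b < a} \<union> {(a, b). a \<in> B \<and> b \<in> C \<and> b < a}" by auto
  moreover have "finite {(a, b). a \<in> A \<and> b \<in> C \<and> b < a}" "finite {(a, b). a \<in> B \<and> b \<in> C \<and> b < a}"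
    using assms by (auto intro: finite_subset[of _ "A \<times> C"] finite_subset[of _ "B \<times> C"])
  moreover have "{(a, b). a \<in> A \<and> b \<in> C \<and> b < a} \<inter> {(a, b). a \<in> B \<and> b \<in> C \<and> b < a} = {}"
    using assms by auto
  ultimately show ?thesis by (simp add: inv_sign_def card_Un_disjoint power_add)
qed

lemma inv_sign_un_right:
  assumes "finite A" "finite B" "finite C" "B \<inter> C = {}"
  shows "inv_sign A (B \<union> C) = (inv_sign A B * inv_sign A C :: 'a)"
proof -
  have "{(a, b). a \<in> A \<and> b \<in> B \<union> C \<and> b < a} =
     {(a, b). a \<in> A \<and> b \<in> B \<and> b < a} \<union> {(a, b). a \<in> A \<and> b \<in> C \<and> b < a}" by auto
  moreover have "finite {(a, b). a \<in> A \<and> b \<in> B \<and> b < a}" "finite {(a, b). a \<in> A \<and> b \<in> C \<and> b < a}"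
    using assms by (auto intro: finite_subset[of _ "A \<times> B"] finite_subset[of _ "A \<times> C"])
  moreover have "{(a, b). a \<in> A \<and> b \<in> B \<and> b < a} \<inter> {(a, b). a \<in> A \<and> b \<in> C \<and> b < a} = {}"
    using assms by auto
  ultimately show ?thesis by (simp add: inv_sign_def card_Un_disjoint power_add)
qed

instance
proof
  fix f g h :: "'a grassmann"
  show "f * g * h = f * (g * h)"
  proof (rule grassmann_eqI)
    fix S :: "nat set" assume S: "finite S"
    let ?t = "\<lambda>A B C. inv_sign A B * inv_sign A C * inv_sign B C * coeff f A * coeff g B * coeff h C"
    have fin: "\<And>A. A \<subseteq> S \<Longrightarrow> finite A" using S finite_subset by auto
    have "coeff (f * g * h) S = (\<Sum>D\<in>Pow S. \<Sum>A\<in>Pow D.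
        inv_sign D (S - D) * (inv_sign A (D - A) * coeff f A * coeff g (D - A)) * coeff h (S - D))"
      unfolding coeff_mult[OF S]
      by (intro sum.cong refl) (simp add: coeff_mult fin sum_distrib_left sum_distrib_right)
    also have "\<dots> = (\<Sum>D\<in>Pow S. \<Sum>A\<in>Pow D. ?t A (D - A) (S - D))"
    proof (intro sum.cong refl)
      fix D A assume "D \<in> Pow S" "A \<in> Pow D"
      then have *: "D = A \<union> (D - A)" "finite A" "finite (D - A)" "finite (S - D)"
        using fin by (auto intro: finite_subset)
      have "inv_sign D (S - D) = (inv_sign A (S - D) * inv_sign (D - A) (S - D) :: 'a)"
        using inv_sign_un_left[OF *(2,3,4)] *(1) by auto
      then show "inv_sign D (S - D) * (inv_sign A (D - A) * coeff f A * coeff g (D - A)) * coeff h (S - D)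
        = ?t A (D - A) (S - D)" by (simp add: mult_ac)
    qed
    also have "\<dots> = (\<Sum>(D, A)\<in>Sigma (Pow S) Pow. ?t A (D - A) (S - D))"
      using fin S by (subst sum.Sigma) auto
    also have "\<dots> = (\<Sum>(A, B)\<in>Sigma (Pow S) (\<lambda>A. Pow (S - A)). ?t A B (S - A - B))"
      by (rule sum.reindex_bij_witness
          [where i = "\<lambda>(A, B). (A \<union> B, A)" and j = "\<lambda>(D, A). (A, D - A)"])
         (auto intro!: arg_cong[where f = "coeff h"] arg_cong[where f = "inv_sign _"]
            arg_cong2[where f = "(*)"])
    also have "\<dots> = (\<Sum>A\<in>Pow S. \<Sum>B\<in>Pow (S - A). ?t A B (S - A - B))"
      using fin S by (subst sum.Sigma) auto
    also have "\<dots> = (\<Sum>A\<in>Pow S. \<Sum>B\<in>Pow (S - A). inv_sign A (S - A) * coeff f A *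
        (inv_sign B (S - A - B) * coeff g B * coeff h (S - A - B)))"
    proof (intro sum.cong refl)
      fix A B assume "A \<in> Pow S" "B \<in> Pow (S - A)"
      then have *: "S - A = B \<union> (S - A - B)" "finite A" "finite B" "finite (S - A - B)"
        using fin S by (auto intro: finite_subset)
      have "inv_sign A (S - A) = (inv_sign A B * inv_sign A (S - A - B) :: 'a)"
        using inv_sign_un_right[OF *(2,3,4)] *(1) by auto
      then show "?t A B (S - A - B) = inv_sign A (S - A) * coeff f A *
        (inv_sign B (S - A - B) * coeff g B * coeff h (S - A - B))" by (simp add: mult_ac)
    qed
    also have "\<dots> = coeff (f * (g * h)) S"
      unfolding coeff_mult[OF S]
      by (intro sum.cong refl) (simp add: coeff_mult fin S sum_distrib_left)
    finally show "coeff (f * g * h) S = coeff (f * (g * h)) S" .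
  qed
  show "1 * f = f"
  proof (rule grassmann_eqI)
    fix S :: "nat set" assume S: "finite S"
    have "coeff (1 * f) S = (\<Sum>A\<in>Pow S. if A = {} then coeff f S else 0)"
      unfolding coeff_mult[OF S] by (intro sum.cong) (auto simp: coeff_simps)
    then show "coeff (1 * f) S = coeff f S" using S by simp
  qed
  show "f * 1 = f"
  proof (rule grassmann_eqI)
    fix S :: "nat set" assume S: "finite S"
    have "coeff (f * 1) S = (\<Sum>A\<in>Pow S. if A = S then coeff f S else 0)"
      unfolding coeff_mult[OF S] by (intro sum.cong) (auto simp: coeff_simps)
    then show "coeff (f * 1) S = coeff f S" using S by simp
  qed
  show "(f + g) * h = f * h + g * h" "f * (g + h) = f * g + f * h"
    by (rule grassmann_eqI, simp add: coeff_mult coeff_simps algebra_simps sum.distrib)+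
  show "(0::'a grassmann) \<noteq> 1"
    by (metis one_grassmann.rep_eq zero_grassmann.rep_eq zero_neq_one)
qed (auto intro!: grassmann_eqI simp: coeff_simps minus_grassmann_def)

end

lift_definition scale :: "'k::comm_ring_1 \<Rightarrow> 'k grassmann \<Rightarrow> 'k grassmann"
  is "\<lambda>c f S. c * f S"
proof -
  fix c :: 'k and f :: "nat set \<Rightarrow> 'k"
  assume f: "finite {S. f S \<noteq> 0} \<and> (\<forall>S. f S \<noteq> 0 \<longrightarrow> finite S)"
  moreover have "{S. c * f S \<noteq> 0} \<subseteq> {S. f S \<noteq> 0}" by auto
  ultimately show "finite {S. c * f S \<noteq> 0} \<and> (\<forall>S. c * f S \<noteq> 0 \<longrightarrow> finite S)"
    by (auto intro: finite_subset)
qed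

lift_definition gen :: "nat \<Rightarrow> 'k::comm_ring_1 grassmann"
  is "\<lambda>i S. if S = {i} then 1 else 0"
  by auto

text \<open>The component of parity \<open>p mod 2\<close> of an element.\<close>

lift_definition part :: "nat \<Rightarrow> 'k::comm_ring_1 grassmann \<Rightarrow> 'k grassmann"
  is "\<lambda>p f S. if card S mod 2 = p mod 2 then f S else 0"
proof -
  fix p and f :: "nat set \<Rightarrow> 'k"
  assume "finite {S. f S \<noteq> 0} \<and> (\<forall>S. f S \<noteq> 0 \<longrightarrow> finite S)"
  then show "finite {S. (if card S mod 2 = p mod 2 then f S else 0) \<noteq> 0} \<and>
      (\<forall>S. (if card S mod 2 = p mod 2 then f S else 0) \<noteq> 0 \<longrightarrow> finite S)"
    by (auto intro: finite_subset[of _ "{S. f S \<noteq> 0}"])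
qed

text \<open>
  The superderivation \<open>\<partial>_i\<close>: it removes \<open>x_i\<close> from a monomial after moving it to the front past
  the generators of smaller index.
\<close>

lift_definition pderiv :: "nat \<Rightarrow> 'k::comm_ring_1 grassmann \<Rightarrow> 'k grassmann"
  is "\<lambda>i f S. if i \<in> S then 0 else (-1) ^ card {j \<in> S. j < i} * f (insert i S)"
proof -
  fix i and f :: "nat set \<Rightarrow> 'k"
  let ?h = "\<lambda>S. if i \<in> S then 0 else (-1) ^ card {j \<in> S. j < i} * f (insert i S)"
  assume f: "finite {S. f S \<noteq> 0} \<and> (\<forall>S. f S \<noteq> 0 \<longrightarrow> finite S)"
  have "{S. ?h S \<noteq> 0} \<subseteq> (\<lambda>S. S - {i}) ` {S. f S \<noteq> 0}"
  proof
    fix S assume "S \<in> {S. ?h S \<noteq> 0}"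
    then have "i \<notin> S" "f (insert i S) \<noteq> 0" by (auto split: if_splits)
    then show "S \<in> (\<lambda>S. S - {i}) ` {S. f S \<noteq> 0}"
      by (intro image_eqI[of _ _ "insert i S"]) auto
  qed
  then have "finite {S. ?h S \<noteq> 0}" using f by (meson finite_imageI finite_subset)
  moreover have "\<forall>S. ?h S \<noteq> 0 \<longrightarrow> finite S"
    using f by (metis finite_insert mult_zero_right)
  ultimately show "finite {S. ?h S \<noteq> 0} \<and> (\<forall>S. ?h S \<noteq> 0 \<longrightarrow> finite S)" by blast
qed

lemma coeff_gen_mult:
  assumes "finite S"
  shows "coeff (gen i * f) S =
    (if i \<in> S then (-1) ^ card {j \<in> S. j < i} * coeff f (S - {i}) else 0)"
proof -
  have "coeff (gen i * f) S =
     (\<Sum>A\<in>Pow S. if A = {i} then inv_sign {i} (S - {i}) * coeff f (S - {i}) else 0)"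
    unfolding coeff_mult[OF assms] by (intro sum.cong) (auto simp: gen.rep_eq)
  moreover have "inv_sign {i} (S - {i}) = ((-1) ^ card {j \<in> S. j < i} :: 'a)"
  proof -
    have "{(a, b). a \<in> {i} \<and> b \<in> S - {i} \<and> b < a} = Pair i ` {j \<in> S. j < i}" by auto
    then show ?thesis by (simp add: inv_sign_def card_image inj_on_def)
  qed
  ultimately show ?thesis using assms by auto
qed

lemma gen_square: "gen i * gen i = (0 :: 'k::comm_ring_1 grassmann)"
  by (rule grassmann_eqI) (auto simp: coeff_gen_mult gen.rep_eq coeff_simps)

lemma gen_anticommute: "gen i * gen j = - (gen j * gen i :: 'k::comm_ring_1 grassmann)"
proof (cases "i = j")
  case True
  then show ?thesis by (simp add: gen_square)
next
  case False
  have *: "{k. k = j \<and> k < i} = (if j < i then {j} else {})" for i j :: nat by auto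
  show ?thesis
  proof (rule grassmann_eqI)
    fix S :: "nat set" assume S: "finite S"
    show "coeff (gen i * gen j) S = coeff (- (gen j * gen i :: 'k grassmann)) S"
    proof (cases "S = {i, j}")
      case True
      have "{k \<in> {i, j}. k < i} = (if j < i then {j} else {})"
        "{k \<in> {i, j}. k < j} = (if i < j then {i} else {})" by auto
      moreover have "{i, j} - {i} = {j}" "{i, j} - {j} = {i}" using False by auto
      ultimately show ?thesis using False True
        by (auto simp: coeff_gen_mult gen.rep_eq coeff_simps)
    next
      case F: False
      then have "\<not> (i \<in> S \<and> S - {i} = {j})" "\<not> (j \<in> S \<and> S - {j} = {i})" by auto
      then show ?thesis using S by (auto simp: coeff_gen_mult gen.rep_eq coeff_simps)
    qed
  qed
qed

lemma pderiv_gen: "pderiv i (gen j) = (if i = j then 1 else 0)"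
  by (rule grassmann_eqI) (auto simp: pderiv.rep_eq gen.rep_eq coeff_simps)

lemma pderiv_linear: "pderiv i (f + g) = pderiv i f + pderiv i g"
    "pderiv i (scale c f) = scale c (pderiv i f)"
  by (rule grassmann_eqI, simp add: pderiv.rep_eq coeff_simps scale.rep_eq algebra_simps)+

lemma pderiv_part: "pderiv i (part q f) = part (q + 1) (pderiv i f)"
proof (rule grassmann_eqI)
  fix S :: "nat set" assume "finite S"
  moreover have "Suc n mod 2 = q mod 2 \<longleftrightarrow> n mod 2 = Suc q mod 2" for n
    by presburger
  ultimately show "coeff (pderiv i (part q f)) S = coeff (part (q + 1) (pderiv i f)) S"
    by (auto simp: pderiv.rep_eq part.rep_eq)
qed

lemma inv_sign_insert_left:
  assumes "finite A" "finite B" "i \<notin> A"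
  shows "inv_sign (insert i A) B = ((-1) ^ card {j \<in> B. j < i} * inv_sign A B :: 'k::comm_ring_1)"
proof -
  have "{(a, b). a \<in> {i} \<and> b \<in> B \<and> b < a} = Pair i ` {j \<in> B. j < i}" by auto
  then have "inv_sign {i} B = ((-1) ^ card {j \<in> B. j < i} :: 'k)"
    by (simp add: inv_sign_def card_image inj_on_def)
  then show ?thesis using inv_sign_un_left[where 'a = 'k, of "{i}" A B] assms by simp
qed

lemma inv_sign_insert_right:
  assumes "finite A" "finite B" "i \<notin> B"
  shows "inv_sign A (insert i B) = ((-1) ^ card {j \<in> A. i < j} * inv_sign A B :: 'k::comm_ring_1)"
proof -
  have "{(a, b). a \<in> A \<and> b \<in> {i} \<and> b < a} = (\<lambda>a. (a, i)) ` {j \<in> A. i < j}" by auto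
  then have "inv_sign A {i} = ((-1) ^ card {j \<in> A. i < j} :: 'k)"
    by (simp add: inv_sign_def card_image inj_on_def)
  then show ?thesis using inv_sign_un_right[where 'a = 'k, of A "{i}" B] assms by simp
qed

lemma sum_Pow_insert:
  assumes "finite T" "i \<notin> T"
  shows "(\<Sum>A\<in>Pow (insert i T). F A) = (\<Sum>A\<in>Pow T. F A + (F (insert i A) :: 'k::comm_ring_1))"
proof -
  have "inj_on (insert i) (Pow T)" using assms(2) by (auto simp: inj_on_def)
  moreover have "Pow T \<inter> insert i ` Pow T = {}" using assms(2) by auto
  ultimately show ?thesis
    using assms by (simp add: Pow_insert sum.union_disjoint sum.reindex sum.distrib)
qed

lemma coeff_part_parity:
  assumes "part p f = f" "finite S"
  shows "(-1) ^ p * coeff f S = (-1) ^ card S * coeff f S"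
proof (cases "coeff f S = 0")
  case False
  then have "card S mod 2 = p mod 2" using assms by (metis part.rep_eq)
  then have "even (card S) = even p" by presburger
  then show ?thesis by (simp add: minus_one_power_iff)
qed simp

lemma pderiv_leibniz:
  fixes f g :: "'k::comm_ring_1 grassmann"
  assumes f: "part p f = f"
  shows "pderiv i (f * g) = pderiv i f * g + scale ((-1) ^ p) (f * pderiv i g)"
proof (rule grassmann_eqI)
  fix S :: "nat set" assume S: "finite S"
  define T where "T = S - {i}"
  have T: "finite T" "i \<notin> T" using S by (auto simp: T_def)
  have fin: "finite A" "finite (T - A)" "i \<notin> A" if "A \<in> Pow T" for A
    using that T finite_subset by auto
  have dif: "insert i T - A = insert i (T - A)" "insert i T - insert i A = T - A" if "A \<in> Pow T" for A
    using that T by auto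
  define lo hi where "lo A = ((-1) ^ card {j \<in> A. j < i} :: 'k)"
    and "hi A = ((-1) ^ card {j \<in> A. i < j} :: 'k)" for A
  have lolo: "lo A * (lo A * x) = x" for A x
    by (simp add: lo_def flip: mult.assoc power_add)
  have lohi: "lo A * hi A = (-1) ^ card A" if "A \<in> Pow T" for A
  proof -
    have "A = {j \<in> A. j < i} \<union> {j \<in> A. i < j}"
      using fin(3)[OF that] nat_neq_iff by blast
    moreover have "card ({j \<in> A. j < i} \<union> {j \<in> A. i < j}) =
        card {j \<in> A. j < i} + card {j \<in> A. i < j}"
      using fin[OF that] by (intro card_Un_disjoint) auto
    ultimately have "card A = card {j \<in> A. j < i} + card {j \<in> A. i < j}" by metis
    then show ?thesis by (simp add: lo_def hi_def power_add)
  qed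
  have lolo': "lo T = lo A * lo (T - A)" if "A \<in> Pow T" for A
  proof -
    have "{j \<in> T. j < i} = {j \<in> A. j < i} \<union> {j \<in> T - A. j < i}" using that by auto
    moreover have "card ({j \<in> A. j < i} \<union> {j \<in> T - A. j < i}) =
        card {j \<in> A. j < i} + card {j \<in> T - A. j < i}"
      using fin[OF that] by (intro card_Un_disjoint) auto
    ultimately have "card {j \<in> T. j < i} = card {j \<in> A. j < i} + card {j \<in> T - A. j < i}"
      by metis
    then show ?thesis by (simp add: lo_def power_add)
  qed
  have p1: "(-1) ^ p * coeff f A = lo A * hi A * coeff f A" if "A \<in> Pow T" for A
    using coeff_part_parity[OF f] fin that lohi by simp
  have p2: "(-1) ^ p * coeff f (insert i A) = - (lo A * hi A * coeff f (insert i A))"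
    if "A \<in> Pow T" for A
    using coeff_part_parity[OF f] fin that lohi by simp
  have sl: "inv_sign (insert i A) (T - A) = lo (T - A) * inv_sign A (T - A)"
    and sr: "inv_sign A (insert i (T - A)) = hi A * inv_sign A (T - A)" if "A \<in> Pow T" for A
    using inv_sign_insert_left[of A "T - A" i] inv_sign_insert_right[of A "T - A" i] fin[OF that] T
    by (auto simp: lo_def hi_def)
  have dsimp: "coeff (pderiv i h) A = lo A * coeff h (insert i A)" if "A \<in> Pow T" for h A
    using fin[OF that] by (simp add: pderiv.rep_eq lo_def)
  have dsimp0: "coeff (pderiv i h) (insert i A) = 0" for h :: "'k grassmann" and A
    by (simp add: pderiv.rep_eq)
  have TA: "T - A \<in> Pow T" for A by auto
  show "coeff (pderiv i (f * g)) S =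
      coeff (pderiv i f * g + scale ((-1) ^ p) (f * pderiv i g)) S"
  proof (cases "i \<in> S")
    case True
    then have S': "S = insert i T" by (auto simp: T_def)
    have "coeff (pderiv i f * g + scale ((-1) ^ p) (f * pderiv i g)) S =
       (\<Sum>A\<in>Pow T. (inv_sign A (S - A) * coeff (pderiv i f) A * coeff g (S - A) +
            inv_sign (insert i A) (S - insert i A) * coeff (pderiv i f) (insert i A) *
              coeff g (S - insert i A)) +
          (inv_sign A (S - A) * ((-1) ^ p * coeff f A) * coeff (pderiv i g) (S - A) +
            inv_sign (insert i A) (S - insert i A) * ((-1) ^ p * coeff f (insert i A)) *
              coeff (pderiv i g) (S - insert i A)))"
      using S T unfolding S'
      by (simp add: coeff_simps scale.rep_eq coeff_mult sum_Pow_insert sum.distrib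
          sum_distrib_left distrib_left mult_ac)
    also have "\<dots> = 0"
    proof (intro sum.neutral ballI)
      fix A assume A: "A \<in> Pow T"
      show "(inv_sign A (S - A) * coeff (pderiv i f) A * coeff g (S - A) +
            inv_sign (insert i A) (S - insert i A) * coeff (pderiv i f) (insert i A) *
              coeff g (S - insert i A)) +
          (inv_sign A (S - A) * ((-1) ^ p * coeff f A) * coeff (pderiv i g) (S - A) +
            inv_sign (insert i A) (S - insert i A) * ((-1) ^ p * coeff f (insert i A)) *
              coeff (pderiv i g) (S - insert i A)) = 0"
        unfolding S' dif[OF A] p2[OF A] dsimp0 dsimp[OF A] dsimp[OF TA] sl[OF A] sr[OF A]
        by (simp add: mult_ac lolo)
    qed
    finally show ?thesis using True by (simp add: pderiv.rep_eq)
  next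
    case False
    then have S': "S = T" by (auto simp: T_def)
    have "coeff (pderiv i (f * g)) S = lo T * coeff (f * g) (insert i T)"
      using False by (simp add: pderiv.rep_eq S' lo_def)
    also have "\<dots> = (\<Sum>A\<in>Pow T. lo T * (inv_sign A (insert i T - A) * coeff f A * coeff g (insert i T - A)
          + inv_sign (insert i A) (insert i T - insert i A) * coeff f (insert i A) *
              coeff g (insert i T - insert i A)))"
      using T by (simp add: coeff_mult sum_Pow_insert sum_distrib_left)
    also have "\<dots> = (\<Sum>A\<in>Pow T. inv_sign A (T - A) * coeff (pderiv i f) A * coeff g (T - A) +
          inv_sign A (T - A) * ((-1) ^ p * coeff f A) * coeff (pderiv i g) (T - A))"
    proof (intro sum.cong refl)
      fix A assume A: "A \<in> Pow T"
      show "lo T * (inv_sign A (insert i T - A) * coeff f A * coeff g (insert i T - A)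
          + inv_sign (insert i A) (insert i T - insert i A) * coeff f (insert i A) *
              coeff g (insert i T - insert i A)) =
          inv_sign A (T - A) * coeff (pderiv i f) A * coeff g (T - A) +
          inv_sign A (T - A) * ((-1) ^ p * coeff f A) * coeff (pderiv i g) (T - A)"
        unfolding dif[OF A] p1[OF A] dsimp[OF A] dsimp[OF TA] sl[OF A] sr[OF A] lolo'[OF A]
        by (simp add: distrib_left mult_ac lolo)
    qed
    also have "\<dots> = coeff (pderiv i f * g + scale ((-1) ^ p) (f * pderiv i g)) S"
      using T by (simp add: S' coeff_simps scale.rep_eq coeff_mult sum.distrib sum_distrib_left
          mult_ac)
    finally show ?thesis .
  qed
qed

section \<open>The pivot elements\<close>

text \<open>
  Unfolding \<open>v_i = \<partial>_i + x_i x_{i+1} v_{i+2}\<close> gives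
  \<open>v_i = \<Sum>k. x_i x_{i+1} \<cdots> x_{i+2k-1} \<partial>_{i+2k}\<close>, a finite sum on each element.
\<close>

definition pivot :: "nat \<Rightarrow> 'k::comm_ring_1 grassmann \<Rightarrow> 'k grassmann" where
  "pivot i f = (\<Sum>k | pderiv (i + 2 * k) f \<noteq> 0.
     prod_list (map gen [i..<i + 2 * k]) * pderiv (i + 2 * k) f)"

lemma finite_pderiv_support: "finite {k. pderiv k f \<noteq> 0}"
proof (rule finite_subset)
  show "{k. pderiv k f \<noteq> 0} \<subseteq> \<Union> {S. coeff f S \<noteq> 0}"
  proof
    fix k assume "k \<in> {k. pderiv k f \<noteq> 0}"
    then obtain S where "coeff (pderiv k f) S \<noteq> 0"
      using grassmann_eqI[of "pderiv k f" 0] by (auto simp: coeff_simps)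
    then have "coeff f (insert k S) \<noteq> 0" by (auto simp: pderiv.rep_eq split: if_splits)
    then show "k \<in> \<Union> {S. coeff f S \<noteq> 0}" by auto
  qed
  show "finite (\<Union> {S. coeff f S \<noteq> 0})"
    using finite_coeff_support coeff_infinite by (intro finite_Union) auto
qed

lemma pivot_rec: "pivot i f = pderiv i f + gen i * gen (i + 1) * pivot (i + 2) f"
proof -
  let ?P = "\<lambda>i k. prod_list (map gen [i..<i + 2 * k]) * pderiv (i + 2 * k) f"
  have "finite {k. pderiv (i + 2 * k) f \<noteq> 0}"
    by (rule finite_subset[OF _ finite_vimageI[OF finite_pderiv_support[of f], of "\<lambda>k. i + 2 * k"]])
      (auto simp: inj_on_def)
  moreover have fin2: "finite {k. pderiv (i + 2 + 2 * k) f \<noteq> 0}"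
    by (rule finite_subset[OF _ finite_vimageI[OF finite_pderiv_support[of f],
            of "\<lambda>k. i + 2 + 2 * k"]]) (auto simp: inj_on_def)
  ultimately have "pivot i f = (\<Sum>k\<in>insert 0 (Suc ` {k. pderiv (i + 2 + 2 * k) f \<noteq> 0}). ?P i k)"
    unfolding pivot_def
  proof (intro sum.mono_neutral_left)
    show "{k. pderiv (i + 2 * k) f \<noteq> 0} \<subseteq> insert 0 (Suc ` {k. pderiv (i + 2 + 2 * k) f \<noteq> 0})"
    proof
      fix k assume "k \<in> {k. pderiv (i + 2 * k) f \<noteq> 0}"
      then show "k \<in> insert 0 (Suc ` {k. pderiv (i + 2 + 2 * k) f \<noteq> 0})" by (cases k) auto
    qed
  qed auto
  also have "\<dots> = pderiv i f + (\<Sum>k | pderiv (i + 2 + 2 * k) f \<noteq> 0. ?P i (Suc k))"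
    using fin2 by (subst sum.insert) (auto simp: sum.reindex)
  also have "(\<Sum>k | pderiv (i + 2 + 2 * k) f \<noteq> 0. ?P i (Suc k)) = gen i * gen (i + 1) * pivot (i + 2) f"
  proof -
    have "[i..<i + 2 * Suc k] = i # (i + 1) # [i + 2..<i + 2 + 2 * k]" for k
      by (simp add: upt_conv_Cons)
    then have "?P i (Suc k) = gen i * gen (i + 1) * ?P (i + 2) k" for k
      by (simp add: mult.assoc)
    then show ?thesis unfolding pivot_def by (simp add: sum_distrib_left)
  qed
  finally show ?thesis .
qed

section \<open>Endomorphisms of the Grassmann algebra and the supercommutator\<close>

type_synonym 'k endo = "'k grassmann \<Rightarrow> 'k grassmann"

definition endo_scale :: "'k::comm_ring_1 \<Rightarrow> 'k endo \<Rightarrow> 'k endo" where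
  "endo_scale c a = (\<lambda>f. scale c (a f))"

global_interpretation endo: vector_space "endo_scale :: 'k::field \<Rightarrow> 'k endo \<Rightarrow> 'k endo"
  by unfold_locales
    (auto simp: endo_scale_def fun_eq_iff scale.rep_eq coeff_simps algebra_simps
      intro!: grassmann_eqI)

text \<open>The component of parity \<open>p mod 2\<close> of an endomorphism.\<close>

definition endo_part :: "nat \<Rightarrow> 'k::comm_ring_1 endo \<Rightarrow> 'k endo" where
  "endo_part p a = (\<lambda>f. part p (a (part 0 f)) + part (p + 1) (a (part 1 f)))"

definition homogeneous :: "nat \<Rightarrow> 'k::comm_ring_1 endo \<Rightarrow> bool" where
  "homogeneous p a \<longleftrightarrow> endo_part p a = a"

text \<open>
  The bilinear extension of \<open>[a, b] = ab - (-1)^(deg a deg b) ba\<close> to arbitrary elements.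
\<close>

definition supercomm :: "'k::comm_ring_1 endo \<Rightarrow> 'k endo \<Rightarrow> 'k endo" where
  "supercomm a b = (\<Sum>p<2. \<Sum>q<2. (endo_part p a \<circ> endo_part q b)
     - endo_scale ((-1) ^ (p * q)) (endo_part q b \<circ> endo_part p a))"

lemma part_simps:
  "part p (0 :: 'k::comm_ring_1 grassmann) = 0"
  "part p (f + g) = part p f + part p (g :: 'k grassmann)"
  "part p (part q h) = (if p mod 2 = q mod 2 then part p h else (0 :: 'k grassmann))"
  by (auto intro!: grassmann_eqI simp: part.rep_eq coeff_simps)

lemma part_sum: "part 0 f + part 1 f = f"
  by (auto intro!: grassmann_eqI simp: part.rep_eq coeff_simps)

lemma endo_part_other:
  assumes "homogeneous p a" "a 0 = 0" "p mod 2 \<noteq> q mod 2"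
  shows "endo_part q a = 0"
proof
  fix f
  have "Suc p mod 2 \<noteq> Suc q mod 2" using assms(3) by presburger
  then have "endo_part q (endo_part p a) f = 0"
    using assms(2,3) by (simp add: endo_part_def part_simps)
  then show "endo_part q a f = 0 f" using assms(1) by (simp add: homogeneous_def)
qed

lemma endo_part_sum:
  assumes "\<And>f g. a (f + g) = a f + a g"
  shows "endo_part 0 a + endo_part 1 a = a"
proof
  fix f
  have *: "part (Suc (Suc 0)) = part 0" by (intro ext grassmann_eqI) (simp add: part.rep_eq)
  have "(endo_part 0 a + endo_part 1 a) f =
      (part 0 (a (part 0 f)) + part 1 (a (part 0 f))) + (part 0 (a (part 1 f)) + part 1 (a (part 1 f)))"
    by (simp add: endo_part_def * ac_simps)
  also have "\<dots> = a f" by (metis assms part_sum)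
  finally show "(endo_part 0 a + endo_part 1 a) f = a f" .
qed

lemma supercomm_homogeneous:
  assumes "homogeneous p a" "homogeneous q b" "p < 2" "q < 2" "a 0 = 0" "b 0 = 0"
  shows "supercomm a b = (a \<circ> b) - endo_scale ((-1) ^ (p * q)) (b \<circ> a)"
proof -
  have two: "{..<2::nat} = {0, 1}" by auto
  have pq: "p \<in> {0, 1}" "q \<in> {0, 1}" using assms(3,4) by auto
  have a: "endo_part r a = (if r = p then a else 0)" if "r \<in> {0, 1}" for r
    using endo_part_other[OF assms(1,5), of r] assms(1) that pq by (auto simp: homogeneous_def)
  have b: "endo_part r b = (if r = q then b else 0)" if "r \<in> {0, 1}" for r
    using endo_part_other[OF assms(2,6), of r] assms(2) that pq by (auto simp: homogeneous_def)
  have z: "a \<circ> (0 :: 'a endo) = 0" "b \<circ> (0 :: 'a endo) = 0"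
    "(0 :: 'a endo) \<circ> a = 0" "(0 :: 'a endo) \<circ> b = 0" "(0 :: 'a endo) \<circ> (0 :: 'a endo) = 0"
    "endo_scale c 0 = (0 :: 'a endo)" for c
    using assms(5,6)
    by (auto simp: fun_eq_iff endo_scale_def scale.rep_eq coeff_simps intro!: grassmann_eqI)
  show ?thesis unfolding supercomm_def two using pq a b z by auto
qed

section \<open>The Lie superalgebra generated by two pivot elements\<close>

text \<open>
  In characteristic 2 a Lie superalgebra is moreover closed under squares of odd elements.
\<close>

inductive_set lie_superalgebra :: "'k::field endo set \<Rightarrow> 'k endo set" for X where
  base: "a \<in> X \<Longrightarrow> a \<in> lie_superalgebra X"
| zero: "0 \<in> lie_superalgebra X"
| add: "a \<in> lie_superalgebra X \<Longrightarrow> b \<in> lie_superalgebra X \<Longrightarrow> a + b \<in> lie_superalgebra X"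
| scale: "a \<in> lie_superalgebra X \<Longrightarrow> endo_scale c a \<in> lie_superalgebra X"
| bracket: "a \<in> lie_superalgebra X \<Longrightarrow> b \<in> lie_superalgebra X \<Longrightarrow>
    supercomm a b \<in> lie_superalgebra X"
| square: "CHAR('k) = 2 \<Longrightarrow> a \<in> lie_superalgebra X \<Longrightarrow> homogeneous 1 a \<Longrightarrow>
    a \<circ> a \<in> lie_superalgebra X"

definition pivot_lie :: "'k::field endo set" where
  "pivot_lie = lie_superalgebra {pivot 0, pivot 1}"

text \<open>\<open>lie_element n1 n2 w\<close>: \<open>w\<close> is a Lie element of multidegree \<open>(n1, n2)\<close> in \<open>v_0\<close>, \<open>v_1\<close>.\<close>

inductive lie_element :: "nat \<Rightarrow> nat \<Rightarrow> 'k::field endo \<Rightarrow> bool" where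
  gen0: "lie_element 1 0 (pivot 0)"
| gen1: "lie_element 0 1 (pivot 1)"
| zero: "lie_element n1 n2 0"
| add: "lie_element n1 n2 a \<Longrightarrow> lie_element n1 n2 b \<Longrightarrow> lie_element n1 n2 (a + b)"
| scale: "lie_element n1 n2 a \<Longrightarrow> lie_element n1 n2 (endo_scale c a)"
| bracket: "lie_element n1 n2 a \<Longrightarrow> lie_element m1 m2 b \<Longrightarrow>
    lie_element (n1 + m1) (n2 + m2) (supercomm a b)"
| square: "CHAR('k) = 2 \<Longrightarrow> lie_element n1 n2 (a :: 'k endo) \<Longrightarrow> homogeneous 1 a \<Longrightarrow>
    lie_element (2 * n1) (2 * n2) (a \<circ> a)"

definition multi_component :: "nat \<Rightarrow> nat \<Rightarrow> 'k::field endo set" where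
  "multi_component n1 n2 = endo.span {w. lie_element n1 n2 w}"

text \<open>
  In characteristic 2 the component of weight 5 is only one-dimensional, spanned by \<open>x_0 x_1 v_3\<close>:
  over other fields \<open>[v_0, v_2] = 2 x_0 x_1 x_3 v_4\<close> is a second basis element. The dimension count
  is therefore a statement about characteristic other than 2.
\<close>

definition weight_component :: "nat \<Rightarrow> 'k::field endo set" where
  "weight_component n = endo.span {w. \<exists>n1 n2. n1 + 2 * n2 = n \<and> w \<in> multi_component n1 n2}"

text \<open>\<open>L\<close> is the direct sum of the subspaces \<open>G 1, G 2, \<dots>\<close>, compatibly with the operations.\<close>

definition lie_gradation :: "'k::field endo set \<Rightarrow> (nat \<Rightarrow> 'k endo set) \<Rightarrow> bool" where
  "lie_gradation L G \<longleftrightarrow>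
     (\<forall>n\<ge>1. endo.subspace (G n)) \<and>
     L = endo.span (\<Union>n\<in>{1..}. G n) \<and>
     (\<forall>N w. finite N \<longrightarrow> N \<subseteq> {1..} \<longrightarrow> (\<forall>n\<in>N. w n \<in> G n) \<longrightarrow> (\<Sum>n\<in>N. w n) = 0 \<longrightarrow>
        (\<forall>n\<in>N. w n = 0)) \<and>
     (\<forall>m\<ge>1. \<forall>n\<ge>1. \<forall>a\<in>G m. \<forall>b\<in>G n. supercomm a b \<in> G (m + n)) \<and>
     (CHAR('k) = 2 \<longrightarrow> (\<forall>n\<ge>1. \<forall>a\<in>G n. homogeneous 1 a \<longrightarrow> a \<circ> a \<in> G (2 * n)))"

end

theory Submission
  imports Defs "HOL-Library.Nat_Bijection"
begin

text \<open>
  The supercommutators of the pivot elements are monomial multiples of pivot elements: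
  \<open>[v_n, v_m] = - x_n \<cdots> x_{m-1} v_{m+1}\<close> for odd \<open>m - n\<close> and
  \<open>[v_n, v_m] = 2 x_n \<cdots> x_{m-1} x_{m+1} v_{m+2}\<close> for even \<open>m - n\<close>. Give \<open>x_i\<close> the weight
  \<open>- 2 ^ i\<close> and \<open>v_i\<close> the weight \<open>2 ^ i\<close>. For each weight \<open>w\<close> and each \<open>m\<close> with \<open>w \<le> 2 ^ m\<close> there
  is exactly one element \<open>x_A v_m\<close> with \<open>A \<subseteq> {0, \<dots>, m - 1}\<close> of weight \<open>w\<close>, by binary expansion of
  \<open>2 ^ m - w\<close>. In characteristic other than 2, the component of weight \<open>w\<close> has as a basis the
  elements with \<open>w \<le> 2 ^ m < 4 w\<close>, apart from \<open>x_0 v_1\<close> and \<open>x_0 x_2 v_3\<close>. Since weights add up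
  under supercommutators, these conditions on \<open>m\<close> are inherited almost automatically, so that the
  elements span a subalgebra. Conversely, \<open>[v_j, x_j x_A v_m] = x_A v_m\<close> for
  \<open>j \<notin> A\<close>, \<open>j < m\<close>, so it suffices to generate the elements with the largest \<open>A\<close>.
  There are exactly two powers of 2 in the interval from \<open>w\<close> to \<open>4 w - 1\<close>.
\<close>

section \<open>Monomials and signs in the Grassmann algebra\<close>

lemma coeff_minus: "coeff (f - g) S = coeff f S - coeff g S"
  unfolding minus_grassmann_def by (simp only: coeff_simps) simp

lemma scale_simps [simp]:
  "scale c (f + g) = scale c f + scale c g"
  "scale c (f - g) = scale c f - scale c g"
  "scale c (- f) = - scale c f"
  "scale (- c) f = - scale c f"
  "scale c 0 = 0" "scale 0 f = 0" "scale 1 f = f"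
  "scale c (scale d f) = scale (c * d) f"
  by (auto intro!: grassmann_eqI simp: scale.rep_eq coeff_simps coeff_minus algebra_simps)

lemma scale_add_left: "scale (c + d) f = scale c f + scale d f"
  by (auto intro!: grassmann_eqI simp: scale.rep_eq coeff_simps algebra_simps)

lemma scale_mult:
  "scale c f * g = scale c (f * g)" "f * scale c g = scale c (f * g)"
  by (auto intro!: grassmann_eqI simp: scale.rep_eq coeff_mult sum_distrib_left mult_ac)

lemma coeff_sum: "coeff (\<Sum>i\<in>A. f i) S = (\<Sum>i\<in>A. coeff (f i) S)"
  by (induction A rule: infinite_finite_induct) (auto simp: coeff_simps)

lemma part_diff [simp]: "part p (f - g) = part p f - part p g"
  by (auto intro!: grassmann_eqI simp: part.rep_eq coeff_simps coeff_minus)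

lemma part_scale: "part p (scale c f) = scale c (part p f)"
  by (auto intro!: grassmann_eqI simp: part.rep_eq scale.rep_eq)

lemma part_cong_mod: "p mod 2 = q mod 2 \<Longrightarrow> part p f = part q f"
  by (auto intro!: grassmann_eqI simp: part.rep_eq)

lemma part_Suc_Suc [simp]: "part (Suc (Suc p)) f = part p f"
  by (rule part_cong_mod) simp

lemma sum_of_parts: "part p f + part (Suc p) f = f"
proof (rule grassmann_eqI)
  fix S :: "nat set"
  have "Suc p mod 2 \<noteq> p mod 2" "card S mod 2 = p mod 2 \<or> card S mod 2 = Suc p mod 2"
    by presburger+
  then show "coeff (part p f + part (Suc p) f) S = coeff f S"
    by (auto simp: part.rep_eq coeff_simps)
qed

text \<open>Every pair in \<open>A \<times> B\<close> is an inversion either of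
  \<open>(A, B)\<close> or, once swapped, of \<open>(B, A)\<close>, so the two inversion counts add
  up to \<open>card A * card B\<close>.\<close>

lemma inv_sign_swap:
  assumes "finite A" "finite B" "A \<inter> B = {}"
  shows "inv_sign A B = ((-1) ^ (card A * card B) * inv_sign B A :: 'k::comm_ring_1)"
proof -
  let ?P = "{(a, b). a \<in> A \<and> b \<in> B \<and> b < a}" and ?Q = "{(a, b). a \<in> A \<and> b \<in> B \<and> a < b}"
  let ?R = "{(a, b). a \<in> B \<and> b \<in> A \<and> b < a}"
  have "?P \<union> ?Q = A \<times> B" using assms(3) by (auto simp: not_less dest: le_neq_implies_less)
  moreover have "finite ?P" "finite ?Q"
    using assms by (auto intro: finite_subset[of _ "A \<times> B"])
  moreover have "?P \<inter> ?Q = {}" by auto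
  ultimately have "card (A \<times> B) = card ?P + card ?Q"
    using card_Un_disjoint[of ?P ?Q] by simp
  then have "card A * card B = card ?P + card ?Q"
    by (simp only: card_cartesian_product)
  moreover have "card ?R = card ?Q"
    by (rule bij_betw_same_card[of prod.swap]) (auto simp: bij_betw_def inj_on_def image_iff)
  moreover have "(-1) ^ (m + n) * (-1) ^ n = ((-1) ^ m :: 'k)" for m n :: nat
    by (simp add: minus_one_power_iff)
  ultimately show ?thesis by (simp add: inv_sign_def)
qed

text \<open>Passing to complements in the convolution sum interchanges the factors. Only subsets
  with the parities prescribed by \<open>p\<close> and \<open>q\<close> contribute, so every swap
  yields the same sign.\<close>

lemma mult_supercommute:
  fixes f g :: "'k::comm_ring_1 grassmann"
  assumes f: "part p f = f" and g: "part q g = g"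
  shows "f * g = scale ((-1) ^ (p * q)) (g * f)"
proof (rule grassmann_eqI)
  fix S :: "nat set" assume S: "finite S"
  have "coeff (f * g) S = (\<Sum>A\<in>Pow S. inv_sign (S - A) A * coeff f (S - A) * coeff g A)"
    unfolding coeff_mult[OF S]
    by (rule sum.reindex_bij_witness[where i = "\<lambda>A. S - A" and j = "\<lambda>A. S - A"])
      (auto simp: double_diff)
  also have "\<dots> = (\<Sum>A\<in>Pow S. (-1) ^ (p * q) * (inv_sign A (S - A) * coeff g A * coeff f (S - A)))"
  proof (intro sum.cong refl)
    fix A assume "A \<in> Pow S"
    then have fin: "finite A" "finite (S - A)" using S finite_subset by auto
    show "inv_sign (S - A) A * coeff f (S - A) * coeff g A =
      (-1) ^ (p * q) * (inv_sign A (S - A) * coeff g A * coeff f (S - A))"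
    proof (cases "coeff f (S - A) = 0 \<or> coeff g A = 0")
      case False
      then have "card (S - A) mod 2 = p mod 2" "card A mod 2 = q mod 2"
        using f g by (metis part.rep_eq)+
      then have "even (card (S - A) * card A) = even (p * q)"
        by (metis even_mult_iff parity_cases even_iff_mod_2_eq_zero)
      then have "(-1) ^ (card (S - A) * card A) = ((-1) ^ (p * q) :: 'k)"
        by (simp add: minus_one_power_iff)
      then have "inv_sign (S - A) A = ((-1) ^ (p * q) * inv_sign A (S - A) :: 'k)"
        using inv_sign_swap[of "S - A" A, where 'k = 'k] fin by auto
      then show ?thesis by (simp add: mult_ac)
    qed auto
  qed
  also have "\<dots> = coeff (scale ((-1) ^ (p * q)) (g * f)) S"
    by (simp add: scale.rep_eq coeff_mult S sum_distrib_left)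
  finally show "coeff (f * g) S = coeff (scale ((-1) ^ (p * q)) (g * f)) S" .
qed

text \<open>The product of the letters in \<open>A\<close> in increasing order. The finiteness test
  makes it zero for infinite \<open>A\<close>, since coefficients at infinite sets must
  vanish.\<close>

lift_definition monomial :: "nat set \<Rightarrow> 'k::comm_ring_1 grassmann"
  is "\<lambda>A S. if S = A \<and> finite A then 1 else 0"
  by auto

lemma coeff_monomial: "finite A \<Longrightarrow> coeff (monomial A) S = (if S = A then 1 else 0)"
  by (simp add: monomial.rep_eq)

lemma monomial_singleton: "monomial {i} = gen i"
  by (rule grassmann_eqI) (simp add: monomial.rep_eq gen.rep_eq)

lemma monomial_empty [simp]: "monomial {} = 1"
  by (rule grassmann_eqI) (simp add: monomial.rep_eq coeff_simps)

lemma part_monomial [simp]: "finite A \<Longrightarrow> part (card A) (monomial A) = monomial A"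
  by (rule grassmann_eqI) (auto simp: monomial.rep_eq part.rep_eq)

lemma part_gen [simp]: "part (Suc 0) (gen i) = gen i"
  by (rule grassmann_eqI) (auto simp: gen.rep_eq part.rep_eq)

lemma coeff_monomial_mult:
  assumes "finite S" "finite A"
  shows "coeff (monomial A * f) S =
    (if A \<subseteq> S then inv_sign A (S - A) * coeff f (S - A) else 0)"
proof -
  have "coeff (monomial A * f) S =
     (\<Sum>B\<in>Pow S. if B = A then inv_sign A (S - A) * coeff f (S - A) else 0)"
    unfolding coeff_mult[OF assms(1)] using assms(2) by (intro sum.cong) (auto simp: monomial.rep_eq)
  then show ?thesis using assms by auto
qed

lemma monomial_mult:
  assumes "finite A" "finite B"
  shows "monomial A * monomial B =
    (if A \<inter> B = {} then scale (inv_sign A B) (monomial (A \<union> B)) else 0)"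
proof (rule grassmann_eqI)
  fix S :: "nat set" assume S: "finite S"
  show "coeff (monomial A * monomial B) S =
    coeff (if A \<inter> B = {} then scale (inv_sign A B) (monomial (A \<union> B)) else 0 :: 'a grassmann) S"
  proof (cases "A \<inter> B = {} \<and> S = A \<union> B")
    case True
    then have "S - A = B" by auto
    then show ?thesis using True S assms
      by (auto simp: coeff_monomial_mult coeff_monomial scale.rep_eq)
  next
    case False
    then have "\<not> (A \<subseteq> S \<and> S - A = B)" by auto
    then show ?thesis using False S assms
      by (auto simp: coeff_monomial_mult coeff_monomial scale.rep_eq coeff_simps)
  qed
qed

lemma mod_2_cong_iff: "m mod 2 = n mod 2 \<longleftrightarrow> even m = even n" for m n :: nat
  by (simp add: mod2_eq_if)

text \<open>Cardinalities add over a disjoint splitting of \<open>S\<close>, and only subsets of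
  parity \<open>p\<close> contribute on the left; so the parity test on \<open>S\<close> becomes a
  test on the complement.\<close>

lemma part_mult:
  assumes "part p f = f"
  shows "part (p + q) (f * g) = f * part q g"
proof (rule grassmann_eqI)
  fix S :: "nat set" assume S: "finite S"
  let ?t = "\<lambda>A. inv_sign A (S - A) * coeff f A * coeff g (S - A)"
  have *: "(if card S mod 2 = (p + q) mod 2 then ?t A else 0) =
      inv_sign A (S - A) * coeff f A * coeff (part q g) (S - A)" if "A \<in> Pow S" for A
  proof (cases "coeff f A = 0")
    case False
    then have "even (card A) = even p"
      by (metis assms part.rep_eq mod_2_cong_iff)
    moreover have "card S = card A + card (S - A)"
      using that S by (metis PowD card_Diff_subset card_mono finite_subset le_add_diff_inverse)
    ultimately have "card S mod 2 = (p + q) mod 2 \<longleftrightarrow> card (S - A) mod 2 = q mod 2"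
      unfolding mod_2_cong_iff by auto
    then show ?thesis by (simp add: part.rep_eq)
  qed simp
  have "coeff (part (p + q) (f * g)) S =
      (\<Sum>A\<in>Pow S. if card S mod 2 = (p + q) mod 2 then ?t A else 0)"
    by (cases "card S mod 2 = (p + q) mod 2") (simp_all add: part.rep_eq coeff_mult S)
  also have "\<dots> = coeff (f * part q g) S"
    unfolding coeff_mult[OF S] by (intro sum.cong refl *)
  finally show "coeff (part (p + q) (f * g)) S = coeff (f * part q g) S" .
qed

text \<open>The descent used in inductions on cardinality: such a coefficient comes from a set with
  two elements fewer.\<close>

lemma coeff_gen_gen_mult:
  assumes S: "finite S" and nz: "coeff (gen i * gen (Suc i) * f) S \<noteq> 0"
  shows "{i, Suc i} \<subseteq> S \<and> coeff f (S - {i, Suc i}) \<noteq> 0"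
proof -
  have c: "coeff (gen i * gen (Suc i) * f) S =
      (if i \<in> S then (-1) ^ card {j \<in> S. j < i} * coeff (gen (Suc i) * f) (S - {i}) else 0)"
    unfolding mult.assoc by (rule coeff_gen_mult[OF S])
  have d: "coeff (gen (Suc i) * f) (S - {i}) = (if Suc i \<in> S - {i} then
      (-1) ^ card {j \<in> S - {i}. j < Suc i} * coeff f (S - {i} - {Suc i}) else 0)"
    by (rule coeff_gen_mult) (use S in simp)
  have "i \<in> S" using nz unfolding c by (meson)
  moreover from this nz have "coeff (gen (Suc i) * f) (S - {i}) \<noteq> 0" unfolding c by auto
  moreover from this have "Suc i \<in> S - {i}" unfolding d by meson
  ultimately have "i \<in> S" "Suc i \<in> S" "coeff f (S - {i} - {Suc i}) \<noteq> 0" unfolding d by auto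
  moreover have "S - {i} - {Suc i} = S - {i, Suc i}" by auto
  ultimately show ?thesis by simp
qed

text \<open>Products of two letters are even, hence central. Supercommutativity is available for
  homogeneous factors, so \<open>f\<close> is split into its parity components.\<close>

lemma gen_gen_commute: "gen i * gen j * f = f * (gen i * gen j :: 'k::comm_ring_1 grassmann)"
proof -
  have 2: "part 2 (gen i * gen j) = (gen i * gen j :: 'k grassmann)"
    using part_mult[OF part_gen, of 1 i "gen j :: 'k grassmann"] by (simp add: numeral_2_eq_2)
  have *: "gen i * gen j * part p f = part p f * (gen i * gen j)" for p
    using mult_supercommute[OF 2, of p "part p f"] by (simp add: part_simps(3))
  have "gen i * gen j * (part 0 f + part 1 f) = (part 0 f + part 1 f) * (gen i * gen j)"
    unfolding distrib_left distrib_right * ..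
  then show ?thesis unfolding part_sum .
qed

section \<open>Calculus of the pivot elements\<close>

lemma coeff_pderiv: "coeff (pderiv i f) S =
    (if i \<in> S then 0 else (-1) ^ card {j \<in> S. j < i} * coeff f (insert i S))"
  by (simp add: pderiv.rep_eq)

lemma pderiv_pderiv: "pderiv i (pderiv i f) = 0"
  by (rule grassmann_eqI) (simp add: coeff_pderiv coeff_simps)

lemma pderiv_anticommute: "pderiv i (pderiv j f) = - pderiv j (pderiv i f)"
proof -
  have less: "pderiv i (pderiv j f) = - pderiv j (pderiv i f)"
    if ij: "i < j" for i j and f :: "'a grassmann"
  proof (rule grassmann_eqI)
    fix S :: "nat set" assume S: "finite S"
    show "coeff (pderiv i (pderiv j f)) S = coeff (- pderiv j (pderiv i f)) S"
    proof (cases "i \<in> S \<or> j \<in> S")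
      case True
      then show ?thesis by (auto simp: coeff_pderiv coeff_simps)
    next
      case False
      \<comment> \<open>Inserting \<open>i\<close> adds one letter that \<open>j\<close> has to
        pass, while inserting \<open>j\<close> does not affect those that \<open>i\<close> passes.
        This is the source of the sign.\<close>
      have "{k \<in> insert i S. k < j} = insert i {k \<in> S. k < j}"
        and "{k \<in> insert j S. k < i} = {k \<in> S. k < i}"
        using ij by auto
      moreover have "card (insert i {k \<in> S. k < j}) = Suc (card {k \<in> S. k < j})"
        using S False by (subst card_insert_disjoint) auto
      ultimately show ?thesis
        using False ij by (simp add: coeff_pderiv coeff_simps insert_commute mult.left_commute)
    qed
  qed
  consider "i < j" | "i = j" | "j < i" by linarith
  then show ?thesis
    by cases (use less[of i j f] less[of j i f] in \<open>simp_all add: pderiv_pderiv\<close>)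
qed

lemma pderiv_0 [simp]: "pderiv i 0 = 0"
  by (rule grassmann_eqI) (simp add: coeff_pderiv coeff_simps)

lemma pderiv_gen_mult:
  "pderiv i (gen j * f) = (if i = j then f else 0) - gen j * pderiv i f"
  using pderiv_leibniz[OF part_gen, of i j f] by (simp add: pderiv_gen)

lemma gen_gen_mult_0 [simp]: "gen i * (gen i * f) = (0 :: 'k::comm_ring_1 grassmann)"
  by (simp add: gen_square flip: mult.assoc)

lemma gen_mult_swap: "gen i * (gen j * f) = - (gen j * (gen i * f) :: 'k::comm_ring_1 grassmann)"
  using arg_cong[OF gen_anticommute[of i j], of "\<lambda>x. x * f"] by (simp add: mult.assoc)

lemma mult_gen_gen: "f * (gen i * (gen j * g)) = gen i * (gen j * (f * g :: 'k::comm_ring_1 grassmann))"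
  using arg_cong[OF gen_gen_commute[of i j f], of "\<lambda>x. x * g"] by (simp add: mult.assoc)

lemma part_gen_mult: "part (Suc q) (gen i * f) = gen i * part q f"
  using part_mult[OF part_gen, of q i f] by simp

lemma pivot_step: "pivot i f = pderiv i f + gen i * (gen (Suc i) * pivot (Suc (Suc i)) f)"
  using pivot_rec[of i f] by (simp add: mult.assoc)

text \<open>
  The recursion for the pivot elements has a unique solution, since multiplication by
  \<open>x_m x_{m+1}\<close> lowers the coefficients to smaller sets. Identities for pivot elements
  are obtained by applying this to the difference of both sides.
\<close>

lemma pivot_recursion_unique:
  assumes "\<And>m. m0 \<le> m \<Longrightarrow> h m = gen m * (gen (Suc m) * h (Suc (Suc m)))" "m0 \<le> m"
  shows "h m = (0 :: 'k::comm_ring_1 grassmann)"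
proof (rule grassmann_eqI)
  fix S :: "nat set" assume "finite S"
  then have "coeff (h m) S = 0" using assms(2)
  proof (induction "card S" arbitrary: S m rule: less_induct)
    case less
    show ?case
    proof (rule ccontr)
      assume nz: "coeff (h m) S \<noteq> 0"
      have "h m = gen m * gen (Suc m) * h (Suc (Suc m))"
        using assms(1)[OF less.prems(2)] by (simp add: mult.assoc)
      then have *: "{m, Suc m} \<subseteq> S" "coeff (h (Suc (Suc m))) (S - {m, Suc m}) \<noteq> 0"
        using coeff_gen_gen_mult[OF less.prems(1), of m "h (Suc (Suc m))"] nz by auto
      moreover have "card (S - {m, Suc m}) < card S"
        using *(1) less.prems(1) by (intro psubset_card_mono) auto
      ultimately show False
        using less.hyps[of "S - {m, Suc m}" "Suc (Suc m)"] less.prems by simp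
    qed
  qed
  then show "coeff (h m) S = coeff 0 S" by (simp add: coeff_simps)
qed

lemma pivot_add: "pivot i (f + g) = pivot i f + pivot i g"
proof -
  have "pivot i (f + g) - (pivot i f + pivot i g) = 0"
  proof (rule pivot_recursion_unique[where ?m0.0 = 0 and
        h = "\<lambda>i. pivot i (f + g) - (pivot i f + pivot i g)"])
    fix m
    show "pivot m (f + g) - (pivot m f + pivot m g) = gen m * (gen (Suc m) *
        (pivot (Suc (Suc m)) (f + g) - (pivot (Suc (Suc m)) f + pivot (Suc (Suc m)) g)))"
      by (simp add: pivot_step[of m] pderiv_linear algebra_simps)
  qed simp
  then show ?thesis by simp
qed

lemma pivot_scale: "pivot i (scale c f) = scale c (pivot i f)"
proof -
  have "pivot i (scale c f) - scale c (pivot i f) = 0"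
  proof (rule pivot_recursion_unique[where ?m0.0 = 0 and
        h = "\<lambda>i. pivot i (scale c f) - scale c (pivot i f)"])
    fix m
    show "pivot m (scale c f) - scale c (pivot m f) =
      gen m * (gen (Suc m) * (pivot (Suc (Suc m)) (scale c f) - scale c (pivot (Suc (Suc m)) f)))"
      by (simp add: pivot_step[of m] pderiv_linear scale_mult algebra_simps)
  qed simp
  then show ?thesis by simp
qed

lemma pivot_0 [simp]: "pivot i 0 = 0"
  using pivot_add[of i 0 0] by simp

lemma pivot_minus: "pivot i (- f) = - pivot i f"
  using pivot_scale[of i "- 1" f] by simp

lemma pivot_part: "pivot i (part q f) = part (Suc q) (pivot i f)"
proof -
  have "pivot i (part q f) - part (Suc q) (pivot i f) = 0"
  proof (rule pivot_recursion_unique[where ?m0.0 = 0 and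
        h = "\<lambda>i. pivot i (part q f) - part (Suc q) (pivot i f)"])
    fix m
    let ?X = "pivot (Suc (Suc m)) f"
    have "part (Suc q) (gen m * (gen (Suc m) * ?X)) = gen m * (gen (Suc m) * part (Suc q) ?X)"
      using part_gen_mult[of "Suc (Suc q)" m "gen (Suc m) * ?X"] part_gen_mult[of "Suc q" "Suc m" ?X]
      by simp
    then show "pivot m (part q f) - part (Suc q) (pivot m f) = gen m * (gen (Suc m) *
        (pivot (Suc (Suc m)) (part q f) - part (Suc q) (pivot (Suc (Suc m)) f)))"
      by (simp add: pivot_step[of m] pderiv_part part_simps(2) right_diff_distrib)
  qed simp
  then show ?thesis by simp
qed

lemma pivot_leibniz:
  assumes f: "part p f = f"
  shows "pivot i (f * g) = pivot i f * g + scale ((-1) ^ p) (f * pivot i g)"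
proof -
  have "pivot i (f * g) - (pivot i f * g + scale ((-1) ^ p) (f * pivot i g)) = 0"
  proof (rule pivot_recursion_unique[where ?m0.0 = 0 and
        h = "\<lambda>i. pivot i (f * g) - (pivot i f * g + scale ((-1) ^ p) (f * pivot i g))"])
    fix m
    show "pivot m (f * g) - (pivot m f * g + scale ((-1) ^ p) (f * pivot m g)) =
      gen m * (gen (Suc m) * (pivot (Suc (Suc m)) (f * g) - (pivot (Suc (Suc m)) f * g +
        scale ((-1) ^ p) (f * pivot (Suc (Suc m)) g))))"
      by (simp add: pivot_step[of m] pderiv_leibniz[OF f] mult_gen_gen[of f] scale_mult
          distrib_left distrib_right right_diff_distrib mult.assoc)
  qed simp
  then show ?thesis by simp
qed

text \<open>From index \<open>m\<close> on the derivative terms drop out of the recursion, and the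
  homogeneous recursion has only the zero solution.\<close>

lemma pivot_eq_0:
  assumes "\<And>k. m \<le> k \<Longrightarrow> pderiv k f = 0"
  shows "pivot m f = 0"
proof (rule pivot_recursion_unique[where ?m0.0 = m and h = "\<lambda>m. pivot m f"])
  fix k assume "m \<le> k"
  then show "pivot k f = gen k * (gen (Suc k) * pivot (Suc (Suc k)) f)"
    using pivot_step[of k f] assms by simp
qed simp

lemma pivot_gen_less: "j < m \<Longrightarrow> pivot m (gen j) = 0"
  by (rule pivot_eq_0) (auto simp: pderiv_gen)

lemma pivot_gen_self: "pivot m (gen m) = 1"
  using pivot_step[of m "gen m"] by (simp add: pderiv_gen pivot_gen_less)

lemma pivot_gen_Suc: "pivot m (gen (Suc m)) = 0"
  using pivot_step[of m "gen (Suc m)"] by (simp add: pderiv_gen pivot_gen_less)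

lemma pivot_gen_mult: "pivot m (gen j * g) = pivot m (gen j) * g - gen j * pivot m g"
  using pivot_leibniz[OF part_gen, of m j g] by simp

text \<open>The operator \<open>v_m\<close> is built from letters and derivations of index at least
  \<open>m\<close>, and each of its terms is odd, so \<open>\<partial>_n\<close> moves past it with
  a single sign.\<close>

lemma pderiv_pivot_less:
  assumes "n < m"
  shows "pderiv n (pivot m f) = - pivot m (pderiv n f)"
proof -
  have "pderiv n (pivot m f) + pivot m (pderiv n f) = 0"
  proof (rule pivot_recursion_unique[where ?m0.0 = m and
        h = "\<lambda>m. pderiv n (pivot m f) + pivot m (pderiv n f)"])
    fix k assume "m \<le> k"
    then show "pderiv n (pivot k f) + pivot k (pderiv n f) =
      gen k * (gen (Suc k) * (pderiv n (pivot (Suc (Suc k)) f) + pivot (Suc (Suc k)) (pderiv n f)))"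
      using assms pderiv_anticommute[of n k f]
      by (simp add: pivot_step[of k] pderiv_linear pderiv_gen_mult distrib_left)
  qed simp
  then show ?thesis by (simp add: eq_neg_iff_add_eq_0)
qed

text \<open>With \<open>v_n = \<partial>_n + x_n x_{n+1} w\<close>, the squares of both summands
  vanish and the mixed terms leave \<open>x_{n+1} w\<close>.\<close>

lemma pivot_square: "pivot n (pivot n f) = gen (Suc n) * pivot (Suc (Suc n)) f"
proof -
  let ?w = "pivot (Suc (Suc n))"
  have "gen n * (gen (Suc n) * (gen n * (gen (Suc n) * ?w (?w f)))) = 0"
    by (subst (2) gen_mult_swap) (simp only: mult_minus_right gen_gen_mult_0 mult_zero_right minus_zero)
  then show ?thesis
    by (simp add: pivot_step[of n] pderiv_linear pderiv_gen pderiv_gen_mult pderiv_pderiv pivot_add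
        pivot_gen_mult pivot_gen_less pivot_gen_Suc pderiv_pivot_less pivot_minus algebra_simps)
qed

lemma pivot_anticommutator_Suc:
  "pivot n (pivot (Suc n) f) + pivot (Suc n) (pivot n f) = - (gen n * pivot (Suc (Suc n)) f)"
proof -
  define ac where "ac = (\<lambda>n f. pivot n (pivot (Suc n) f) + pivot (Suc n) (pivot n f) :: 'a grassmann)"
  have *: "ac n f = - (gen n * pivot (Suc (Suc n)) f) + gen n * (gen (Suc n) * ac (Suc n) f)" for n f
    unfolding ac_def
    by (simp add: pivot_step[of n] pderiv_pivot_less pivot_add pivot_gen_mult pivot_gen_less
        pivot_gen_self pivot_minus algebra_simps)
  \<comment> \<open>By \<open>*\<close> every term of \<open>ac n f\<close> begins with
    \<open>x_n\<close>. At the index \<open>n + 1\<close> this kills the last term of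
    \<open>*\<close>, so the recursion stops after one step.\<close>
  have "gen n * ac n f = 0" for n f
    unfolding *[of n] by (simp add: right_diff_distrib)
  then show ?thesis using *[of n f] by (simp add: ac_def)
qed

text \<open>Since \<open>\<partial>_n\<close>, \<open>x_n\<close> and \<open>x_{n+1}\<close>
  supercommute with \<open>v_m\<close> for such \<open>m\<close>, only the tail
  \<open>v_{n+2}\<close> of \<open>v_n\<close> interacts with it.\<close>

lemma pivot_anticommutator_step:
  assumes "Suc (Suc n) \<le> m"
  shows "pivot n (pivot m f) + pivot m (pivot n f) = gen n * (gen (Suc n) *
    (pivot (Suc (Suc n)) (pivot m f) + pivot m (pivot (Suc (Suc n)) f)))"
  using assms by (simp add: pivot_step[of n] pderiv_pivot_less pivot_add pivot_gen_mult
      pivot_gen_less distrib_left)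

text \<open>A letter put in front of larger letters creates no inversion, so no sign
  appears.\<close>

lemma gen_mult_monomial:
  assumes "finite A" "\<And>a. a \<in> A \<Longrightarrow> i < a"
  shows "gen i * monomial A = (monomial (insert i A) :: 'a::comm_ring_1 grassmann)"
proof -
  have "{(a, b). a \<in> {i} \<and> b \<in> A \<and> b < a} = {}" "i \<notin> A" using assms(2) by fastforce+
  then have "inv_sign {i} A = (1 :: 'a)" by (simp only: inv_sign_def card.empty power_0)
  then show ?thesis
    using monomial_mult[of "{i}" A, where 'a = 'a] assms(1) \<open>i \<notin> A\<close> by (simp add: monomial_singleton)
qed

lemma gen_gen_mult_monomial:
  assumes "finite A" "\<And>a. a \<in> A \<Longrightarrow> Suc i < a" "B = insert i (insert (Suc i) A)"
  shows "gen i * (gen (Suc i) * (monomial A * g)) = (monomial B * g :: 'a::comm_ring_1 grassmann)"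
proof -
  have "gen (Suc i) * monomial A = (monomial (insert (Suc i) A) :: 'a grassmann)"
    by (rule gen_mult_monomial) (use assms in auto)
  moreover have "gen i * monomial (insert (Suc i) A) = (monomial B :: 'a grassmann)"
    unfolding assms(3) by (rule gen_mult_monomial) (use assms in force)+
  ultimately have "gen i * (gen (Suc i) * monomial A) = (monomial B :: 'a grassmann)" by simp
  then show ?thesis by (metis mult.assoc)
qed

text \<open>The lower index rises in steps of two while the upper one stays fixed, each step putting
  two letters in front. The base case is twice the square of one pivot element.\<close>

lemma pivot_anticommutator_even:
  "pivot n (pivot (n + 2 * k) f) + pivot (n + 2 * k) (pivot n f) =
    scale 2 (monomial (insert (n + 2 * k + 1) {n..<n + 2 * k}) * pivot (n + 2 * k + 2) f :: 'a::comm_ring_1 grassmann)"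
proof (induction k arbitrary: n)
  case 0
  then show ?case
    using scale_add_left[of 1 1 "gen (Suc n) * pivot (Suc (Suc n)) f"]
    by (simp add: pivot_square monomial_singleton)
next
  case (Suc k)
  let ?A = "insert (n + 2 * Suc k + 1) {n + 2..<n + 2 * Suc k}"
  have "gen n * (gen (Suc n) * (monomial ?A * g)) =
      (monomial (insert (n + 2 * Suc k + 1) {n..<n + 2 * Suc k}) * g :: 'a grassmann)" for g
    by (rule gen_gen_mult_monomial) auto
  moreover have "n + 2 * Suc k = n + 2 + 2 * k" by simp
  ultimately show ?case
    using Suc.IH[of "n + 2"] pivot_anticommutator_step[of n "n + 2 * Suc k" f]
    by (simp add: scale_mult)
qed

text \<open>As in the even case, but the base case has two consecutive indices.\<close>

lemma pivot_anticommutator_odd: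
  "pivot n (pivot (n + 2 * k + 1) f) + pivot (n + 2 * k + 1) (pivot n f) =
    - (monomial {n..<n + 2 * k + 1} * pivot (n + 2 * k + 2) f :: 'a::comm_ring_1 grassmann)"
proof (induction k arbitrary: n)
  case 0
  then show ?case
    using pivot_anticommutator_Suc[of n f] by (simp add: monomial_singleton)
next
  case (Suc k)
  let ?A = "{n + 2..<n + 2 * Suc k + 1}"
  have "gen n * (gen (Suc n) * (monomial ?A * g)) =
      (monomial {n..<n + 2 * Suc k + 1} * g :: 'a grassmann)" for g
    by (rule gen_gen_mult_monomial) auto
  moreover have "n + 2 * Suc k = n + 2 + 2 * k" by simp
  ultimately show ?case
    using Suc.IH[of "n + 2"] pivot_anticommutator_step[of n "n + 2 * Suc k + 1" f]
    by simp
qed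

section \<open>Linear, parity-graded and weight-graded endomorphisms\<close>

definition linear_endo :: "'k::comm_ring_1 endo \<Rightarrow> bool" where
  "linear_endo a \<longleftrightarrow> (\<forall>f g. a (f + g) = a f + a g) \<and> (\<forall>c f. a (scale c f) = scale c (a f))"

text \<open>This form of parity implies \<open>homogeneous\<close> and composes by adding
  degrees.\<close>

definition graded_endo :: "nat \<Rightarrow> 'k::comm_ring_1 endo \<Rightarrow> bool" where
  "graded_endo p a \<longleftrightarrow> (\<forall>q f. a (part q f) = part (p + q) (a f))"

text \<open>
  Giving \<open>x_i\<close> the weight \<open>- 2 ^ i\<close>, the monomial with letters \<open>S\<close> has weight
  \<open>- set_encode S\<close>, so that every weight space of the Grassmann algebra is at most
  one-dimensional: an operator of weight \<open>w\<close> computes the coefficient at \<open>T\<close> from the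
  coefficient at the only set whose code is \<open>set_encode T + w\<close>.
\<close>

definition weight_endo :: "nat \<Rightarrow> 'k::comm_ring_1 endo \<Rightarrow> bool" where
  "weight_endo w a \<longleftrightarrow> (\<forall>f g S T. finite S \<longrightarrow> finite T \<longrightarrow> set_encode S = set_encode T + w \<longrightarrow>
     coeff f S = coeff g S \<longrightarrow> coeff (a f) T = coeff (a g) T)"

section \<open>Closure properties of linearity and of the weight condition\<close>

lemma linear_endoI:
  "(\<And>f g. a (f + g) = a f + a g) \<Longrightarrow> (\<And>c f. a (scale c f) = scale c (a f)) \<Longrightarrow> linear_endo a"
  by (simp add: linear_endo_def)

lemma linear_endoD:
  assumes "linear_endo a"
  shows "a (f + g) = a f + a g" "a (scale c f) = scale c (a f)" "a 0 = 0"
    "a (- f) = - a f" "a (f - g) = a f - a g"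
proof -
  show *: "a (f + g) = a f + a g" "a (scale c f) = scale c (a f)" for f g c
    using assms by (auto simp: linear_endo_def)
  show "a 0 = 0" using *(2)[of 0 0] by simp
  show **: "a (- f) = - a f" for f using *(2)[of "-1" f] by simp
  show "a (f - g) = a f - a g" using *(1)[of f "- g"] by (simp add: **)
qed

lemma endo_apply:
  "(a + b) f = a f + b f" "(a - b) f = a f - b f" "(0 :: 'k::comm_ring_1 endo) f = 0"
  "endo_scale c a f = scale c (a f)"
  for a b :: "'k::comm_ring_1 endo"
  by (simp_all add: endo_scale_def)

lemma linear_endo_pivot: "linear_endo (pivot n)"
  by (intro linear_endoI pivot_add pivot_scale)

lemma linear_endo_part: "linear_endo (part p)"
  by (intro linear_endoI part_simps part_scale)

lemma linear_endo_zero: "linear_endo 0"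
  by (intro linear_endoI) simp_all

lemma linear_endo_add: "linear_endo a \<Longrightarrow> linear_endo b \<Longrightarrow> linear_endo (a + b)"
  by (intro linear_endoI) (simp_all add: linear_endoD)

lemma linear_endo_scale: "linear_endo a \<Longrightarrow> linear_endo (endo_scale c a)"
  by (intro linear_endoI) (simp_all add: linear_endoD endo_scale_def mult.commute)

lemma linear_endo_comp: "linear_endo a \<Longrightarrow> linear_endo b \<Longrightarrow> linear_endo (a \<circ> b)"
  by (intro linear_endoI) (simp_all add: linear_endoD)

lemma weight_endoD:
  "weight_endo w a \<Longrightarrow> finite S \<Longrightarrow> finite T \<Longrightarrow> set_encode S = set_encode T + w \<Longrightarrow>
    coeff f S = coeff g S \<Longrightarrow> coeff (a f) T = coeff (a g) T"
  unfolding weight_endo_def by blast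

lemma set_encode_shift:
  obtains S where "finite S" "set_encode S = m"
  by (metis finite_set_decode set_decode_inverse)

lemma weight_endo_part: "weight_endo 0 (part p)"
  unfolding weight_endo_def by (auto simp: part.rep_eq set_encode_eq)

lemma weight_endo_zero: "weight_endo w 0"
  by (simp add: weight_endo_def)

lemma weight_endo_add: "weight_endo w a \<Longrightarrow> weight_endo w b \<Longrightarrow> weight_endo w (a + b)"
  unfolding weight_endo_def plus_fun_def coeff_simps by metis

lemma weight_endo_scale: "weight_endo w a \<Longrightarrow> weight_endo w (endo_scale c a)"
  unfolding weight_endo_def endo_scale_def scale.rep_eq by metis

lemma weight_endo_comp:
  assumes "weight_endo v a" "weight_endo w b"
  shows "weight_endo (v + w) (a \<circ> b)"
  unfolding weight_endo_def
proof (intro allI impI)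
  fix f g :: "'a grassmann" and S T :: "nat set"
  assume *: "finite S" "finite T" "set_encode S = set_encode T + (v + w)" "coeff f S = coeff g S"
  obtain U where U: "finite U" "set_encode U = set_encode T + v" by (rule set_encode_shift)
  then have "coeff (b f) U = coeff (b g) U"
    using weight_endoD[OF assms(2), of S U f g] * by simp
  then show "coeff ((a \<circ> b) f) T = coeff ((a \<circ> b) g) T"
    unfolding comp_apply by (rule weight_endoD[OF assms(1) U(1) *(2) U(2)])
qed

text \<open>By induction on \<open>card T\<close>. The derivative reads the coefficient at
  \<open>insert n T\<close>. In the other summand \<open>T\<close> loses \<open>n\<close> and
  \<open>n + 1\<close>, and \<open>2 ^ n + 2 ^ n + 2 ^ (n + 1) = 2 ^ (n + 2)\<close> is the weight
  of the next pivot element.\<close>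

lemma weight_endo_pivot: "weight_endo (2 ^ n) (pivot n :: 'k::comm_ring_1 endo)"
proof -
  have "coeff (pivot n f) T = coeff (pivot n g) T"
    if "finite T" "finite S" "set_encode S = set_encode T + 2 ^ n" "coeff f S = coeff g S"
    for f g :: "'k grassmann" and S T
    using that
  proof (induction "card T" arbitrary: T n rule: less_induct)
    case less
    have p: "coeff (pderiv n f) T = coeff (pderiv n g) T"
    proof (cases "n \<in> T")
      case True
      then show ?thesis by (simp add: coeff_pderiv)
    next
      case False
      then have "set_encode (insert n T) = set_encode S"
        using less.prems by simp
      then have "insert n T = S"
        using set_encode_eq[of "insert n T" S] less.prems(1,2) by (simp only: finite_insert)
      then show ?thesis using less.prems by (simp add: coeff_pderiv)
    qed
    have q: "coeff (gen n * gen (Suc n) * pivot (Suc (Suc n)) f) T =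
      coeff (gen n * gen (Suc n) * pivot (Suc (Suc n)) g) T"
    proof (cases "{n, Suc n} \<subseteq> T")
      case False
      then show ?thesis using coeff_gen_gen_mult[OF less.prems(1)] by metis
    next
      case True
      define U where "U = T - {n, Suc n}"
      have U: "finite U" "n \<notin> U" "Suc n \<notin> U" "T = insert n (insert (Suc n) U)"
        "T - {n} - {Suc n} = U"
        using True less.prems(1) by (auto simp: U_def)
      have "set_encode T = 2 ^ n + (2 ^ Suc n + set_encode U)"
        unfolding U(4) using U(1-3) by simp
      then have "set_encode S = set_encode U + 2 ^ Suc (Suc n)"
        using less.prems(3) by simp
      moreover have "card U < card T"
        using U(1-3) unfolding U(4) by simp
      ultimately have *: "coeff (pivot (Suc (Suc n)) f) U = coeff (pivot (Suc (Suc n)) g) U"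
        using less.hyps[of U "Suc (Suc n)"] less.prems(2,4) U(1) by blast
      have fin: "finite (T - {n})" using less.prems(1) by simp
      show ?thesis
        unfolding mult.assoc coeff_gen_mult[OF less.prems(1)] coeff_gen_mult[OF fin] U(5) * ..
    qed
    show ?case
      unfolding pivot_step[of n f] pivot_step[of n g] coeff_simps p
      using q by (simp add: mult.assoc)
  qed
  then show ?thesis unfolding weight_endo_def by blast
qed

lemma endo_part_eq: "endo_part p a = (part p \<circ> a \<circ> part 0) + (part (p + 1) \<circ> a \<circ> part 1)"
  by (simp add: endo_part_def fun_eq_iff)

lemma linear_endo_endo_part: "linear_endo a \<Longrightarrow> linear_endo (endo_part p a)"
  unfolding endo_part_eq by (intro linear_endo_add linear_endo_comp linear_endo_part)

lemma weight_endo_endo_part: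
  assumes "weight_endo w a"
  shows "weight_endo w (endo_part p a)"
proof -
  have "weight_endo w (part q \<circ> a \<circ> part r)" for q r
    using weight_endo_comp[OF weight_endo_comp[OF weight_endo_part assms] weight_endo_part] by simp
  then show ?thesis unfolding endo_part_eq by (intro weight_endo_add)
qed

text \<open>Only sums, composites and scalings occur here, so closure under these operations
  transfers to the supercommutator.\<close>

lemma supercomm_eq: "supercomm a b =
    ((endo_part 0 a \<circ> endo_part 0 b) + endo_scale (- 1) (endo_part 0 b \<circ> endo_part 0 a)) +
    ((endo_part 0 a \<circ> endo_part 1 b) + endo_scale (- 1) (endo_part 1 b \<circ> endo_part 0 a)) +
    ((endo_part 1 a \<circ> endo_part 0 b) + endo_scale (- 1) (endo_part 0 b \<circ> endo_part 1 a)) +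
    ((endo_part 1 a \<circ> endo_part 1 b) + endo_scale 1 (endo_part 1 b \<circ> endo_part 1 a))"
proof -
  have "{..<2::nat} = {0, 1}" by auto
  then show ?thesis
    by (simp add: supercomm_def fun_eq_iff endo_scale_def)
qed

lemma linear_endo_supercomm: "linear_endo a \<Longrightarrow> linear_endo b \<Longrightarrow> linear_endo (supercomm a b)"
  unfolding supercomm_eq
  by (intro linear_endo_add linear_endo_scale linear_endo_comp linear_endo_endo_part)

lemma weight_endo_supercomm:
  assumes "weight_endo v a" "weight_endo w b"
  shows "weight_endo (v + w) (supercomm a b)"
proof -
  have 1: "weight_endo (v + w) (endo_part p a \<circ> endo_part q b)" for p q
    using assms by (intro weight_endo_comp weight_endo_endo_part)
  have 2: "weight_endo (v + w) (endo_part q b \<circ> endo_part p a)" for p q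
    unfolding add.commute[of v w] using assms by (intro weight_endo_comp weight_endo_endo_part)
  show ?thesis unfolding supercomm_eq
    by (intro weight_endo_add weight_endo_scale 1 2)
qed

section \<open>Bilinearity of the supercommutator and reduction to spanning sets\<close>

lemma endo_part_add: "endo_part p (a + b) = endo_part p a + endo_part p b"
  by (simp add: endo_part_def fun_eq_iff part_simps(2) ac_simps)

lemma endo_part_scale: "endo_part p (endo_scale c a) = endo_scale c (endo_part p a)"
  by (simp add: endo_part_def fun_eq_iff endo_scale_def part_scale)

lemma endo_part_zero [simp]: "endo_part p 0 = 0"
  by (simp add: endo_part_def fun_eq_iff part_simps(1))

lemma supercomm_left:
  assumes "linear_endo b"
  shows "supercomm (endo_scale c a + a') b = endo_scale c (supercomm a b) + supercomm a' b"
  using linear_endo_endo_part[OF assms]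
  by (simp add: supercomm_eq endo_part_add endo_part_scale fun_eq_iff endo_apply(4) linear_endoD
      algebra_simps)

lemma supercomm_right:
  assumes "linear_endo a"
  shows "supercomm a (endo_scale c b + b') = endo_scale c (supercomm a b) + supercomm a b'"
  using linear_endo_endo_part[OF assms]
  by (simp add: supercomm_eq endo_part_add endo_part_scale fun_eq_iff endo_apply(4) linear_endoD
      algebra_simps)

lemma supercomm_zero:
  fixes a :: "'a::comm_ring_1 endo"
  assumes "linear_endo a"
  shows "supercomm a 0 = 0" "supercomm 0 a = 0"
proof -
  have "endo_scale 1 x = x" "endo_scale 1 0 = (0 :: 'a endo)" for x :: "'a endo"
    by (simp_all add: fun_eq_iff endo_apply(4))
  then show "supercomm a 0 = 0" "supercomm 0 a = 0"
    using supercomm_right[OF assms, of 1 0 0] supercomm_left[OF assms, of 1 0 0] by simp_all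
qed

lemma linear_endo_span:
  assumes "a \<in> endo.span A" "\<And>x. x \<in> A \<Longrightarrow> linear_endo x"
  shows "linear_endo a"
  using assms(1)
proof (induction rule: endo.span_induct_alt)
  case base
  show ?case by (rule linear_endo_zero)
next
  case (step c x y)
  then show ?case by (intro linear_endo_add[OF linear_endo_scale[OF assms(2)]])
qed

lemma weight_endo_span:
  assumes "a \<in> endo.span A" "\<And>x. x \<in> A \<Longrightarrow> weight_endo w x"
  shows "weight_endo w a"
  using assms(1)
proof (induction rule: endo.span_induct_alt)
  case base
  show ?case by (rule weight_endo_zero)
next
  case (step c x y)
  then show ?case by (intro weight_endo_add[OF weight_endo_scale[OF assms(2)]])
qed

lemma supercomm_span:
  assumes a: "a \<in> endo.span A" and b: "b \<in> endo.span B"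
    and A: "\<And>x. x \<in> A \<Longrightarrow> linear_endo x" and B: "\<And>x. x \<in> B \<Longrightarrow> linear_endo x"
    and AB: "\<And>x y. x \<in> A \<Longrightarrow> y \<in> B \<Longrightarrow> supercomm x y \<in> endo.span C"
  shows "supercomm a b \<in> endo.span C"
proof -
  have *: "supercomm x b \<in> endo.span C" if "x \<in> A" for x
    using b
  proof (induction rule: endo.span_induct_alt)
    case base
    show ?case unfolding supercomm_zero(1)[OF A[OF that]] by (rule endo.span_zero)
  next
    case (step c y z)
    show ?case
      unfolding supercomm_right[OF A[OF that]]
      by (rule endo.span_add[OF endo.span_scale[OF AB[OF that step(1)]] step(2)])
  qed
  have "linear_endo b" using b B by (rule linear_endo_span)
  show ?thesis using a
  proof (induction rule: endo.span_induct_alt)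
    case base
    show ?case unfolding supercomm_zero(2)[OF \<open>linear_endo b\<close>] by (rule endo.span_zero)
  next
    case (step c y z)
    show ?case
      unfolding supercomm_left[OF \<open>linear_endo b\<close>]
      by (rule endo.span_add[OF endo.span_scale[OF *[OF step(1)]] step(2)])
  qed
qed

text \<open>Operators of different weights compute the coefficient at \<open>T\<close> from
  different sets. Evaluated at a multiple of the one monomial seen by \<open>w m\<close>, all other
  terms vanish at \<open>T\<close>.\<close>

lemma weight_endo_independent:
  assumes N: "finite N" and lin: "\<And>n. n \<in> N \<Longrightarrow> linear_endo (w n)"
    and wt: "\<And>n. n \<in> N \<Longrightarrow> weight_endo n (w n)" and sum: "(\<Sum>n\<in>N. w n) = 0" and "m \<in> N"
  shows "w m = 0"
proof (intro ext grassmann_eqI)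
  fix f :: "'a grassmann" and T :: "nat set" assume T: "finite T"
  obtain S where S: "finite S" "set_encode S = set_encode T + m" by (rule set_encode_shift)
  define g where "g = scale (coeff f S) (monomial S :: 'a grassmann)"
  have g: "coeff g U = (if U = S then coeff f S else 0)" for U
    using S by (simp add: g_def scale.rep_eq coeff_monomial)
  have "coeff (w n g) T = 0" if "n \<in> N" "n \<noteq> m" for n
  proof -
    obtain U where U: "finite U" "set_encode U = set_encode T + n" by (rule set_encode_shift)
    then have "coeff g U = coeff 0 U" using g S that by (auto simp: coeff_simps)
    then show ?thesis
      using weight_endoD[OF wt[OF that(1)] U(1) T U(2), of g 0] linear_endoD(3)[OF lin[OF that(1)]]
      by (simp add: coeff_simps)
  qed
  then have "(\<Sum>n\<in>N. coeff (w n g) T) = (\<Sum>n\<in>{m}. coeff (w n g) T)"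
    using N \<open>m \<in> N\<close> by (intro sum.mono_neutral_right) auto
  moreover have "(\<Sum>n\<in>N. w n) g = (\<Sum>n\<in>N. w n g)"
    using N by (induction N rule: finite_induct) auto
  ultimately have "coeff (w m g) T = 0"
    using sum by (simp add: coeff_simps flip: coeff_sum)
  moreover have "coeff (w m f) T = coeff (w m g) T"
    using weight_endoD[OF wt[OF \<open>m \<in> N\<close>] S(1) T S(2), of f g] g by simp
  ultimately show "coeff (w m f) T = coeff ((0 :: 'a endo) f) T" by (simp add: coeff_simps)
qed

section \<open>Parity of endomorphisms\<close>

lemma graded_endoD: "graded_endo p a \<Longrightarrow> a (part q f) = part (p + q) (a f)"
  by (simp add: graded_endo_def)

lemma graded_endo_pivot: "graded_endo 1 (pivot n)"
  by (simp add: graded_endo_def pivot_part)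

lemma graded_endo_zero: "graded_endo p 0"
  by (simp add: graded_endo_def part_simps(1))

lemma graded_endo_add: "graded_endo p a \<Longrightarrow> graded_endo p b \<Longrightarrow> graded_endo p (a + b)"
  by (simp add: graded_endo_def part_simps(2))

lemma graded_endo_scale:
  "linear_endo a \<Longrightarrow> graded_endo p a \<Longrightarrow> graded_endo p (endo_scale c a)"
  by (simp add: graded_endo_def endo_scale_def part_scale)

lemma graded_endo_comp: "graded_endo p a \<Longrightarrow> graded_endo q b \<Longrightarrow> graded_endo (p + q) (a \<circ> b)"
  by (simp add: graded_endo_def add.assoc)

lemma endo_part_cong_mod: "p mod 2 = q mod 2 \<Longrightarrow> endo_part p a = endo_part q a"
  unfolding endo_part_def
  by (metis (no_types, lifting) mod_add_left_eq part_cong_mod)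

lemma graded_imp_homogeneous:
  assumes "graded_endo p a" "p mod 2 = q mod 2"
  shows "homogeneous q a"
proof -
  have "endo_part p a f = a f" for f
    using sum_of_parts[of p "a f"]
    by (simp add: endo_part_def graded_endoD[OF assms(1)] part_simps(3))
  then show ?thesis
    using endo_part_cong_mod[OF assms(2), of a] by (auto simp: homogeneous_def fun_eq_iff)
qed

lemma endo_part_graded:
  assumes "graded_endo p a" "linear_endo a"
  shows "endo_part q a = (if p mod 2 = q mod 2 then a else 0)"
  using graded_imp_homogeneous[OF assms(1), of q] graded_imp_homogeneous[OF assms(1), of p]
    endo_part_other[of p a q] linear_endoD(3)[OF assms(2)]
  by (auto simp: homogeneous_def)

lemma supercomm_graded:
  assumes "graded_endo p a" "graded_endo q b" "linear_endo a" "linear_endo b"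
  shows "supercomm a b f = a (b f) - scale ((-1) ^ (p * q)) (b (a f))"
proof -
  have "even ((p mod 2) * (q mod 2)) = even (p * q)" by simp
  then have "(-1) ^ ((p mod 2) * (q mod 2)) = ((-1) ^ (p * q) :: 'a)"
    by (simp add: minus_one_power_iff)
  moreover have "homogeneous (p mod 2) a" "homogeneous (q mod 2) b"
    using assms by (auto intro: graded_imp_homogeneous)
  ultimately show ?thesis
    using supercomm_homogeneous[of "p mod 2" a "q mod 2" b] assms
    by (simp add: linear_endoD endo_scale_def)
qed

lemma graded_endo_supercomm:
  assumes "graded_endo p a" "graded_endo q b" "linear_endo a" "linear_endo b"
  shows "graded_endo (p + q) (supercomm a b)"
  unfolding graded_endo_def
  by (simp add: supercomm_graded[OF assms] graded_endoD[OF assms(1)] graded_endoD[OF assms(2)]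
      part_scale add.assoc add.left_commute)

text \<open>
  Expanding \<open>(c x + y)\<^sup>2\<close> for odd \<open>x\<close>, \<open>y\<close> produces the supercommutator of \<open>x\<close> and \<open>y\<close>.
\<close>

lemma square_span:
  assumes a: "a \<in> endo.span B"
    and lin: "\<And>x. x \<in> B \<Longrightarrow> linear_endo x" and odd: "\<And>x. x \<in> B \<Longrightarrow> graded_endo 1 x"
    and comm: "\<And>x y. x \<in> B \<Longrightarrow> y \<in> B \<Longrightarrow> supercomm x y \<in> endo.span C"
    and sq: "\<And>x. x \<in> B \<Longrightarrow> x \<circ> x \<in> endo.span C"
  shows "a \<circ> a \<in> endo.span C"
proof -
  have "linear_endo a \<and> graded_endo 1 a \<and> a \<in> endo.span B \<and> a \<circ> a \<in> endo.span C"
    using a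
  proof (induction rule: endo.span_induct_alt)
    case base
    have "(0 :: 'a endo) \<circ> 0 = 0" by (simp add: fun_eq_iff)
    then have "(0 :: 'a endo) \<circ> 0 \<in> endo.span C" using endo.span_zero by metis
    then show ?case
      using linear_endo_zero graded_endo_zero endo.span_zero by blast
  next
    case (step c x y)
    note x = lin[OF step(1)] odd[OF step(1)] and y = step(2)
    have "supercomm x y \<in> endo.span C"
      by (rule supercomm_span[OF endo.span_base[OF step(1)] _ lin lin comm]) (use y in auto)
    then have "endo_scale (c * c) (x \<circ> x) + (endo_scale c (supercomm x y) + (y \<circ> y)) \<in> endo.span C"
      using y by (intro endo.span_add endo.span_scale sq[OF step(1)]) blast+
    moreover have "(endo_scale c x + y) \<circ> (endo_scale c x + y) =
        endo_scale (c * c) (x \<circ> x) + (endo_scale c (supercomm x y) + (y \<circ> y))"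
      using supercomm_graded[OF x(2) _ x(1), of 1 y] y x
      by (simp add: fun_eq_iff endo_apply(4) linear_endoD algebra_simps)
    ultimately have "(endo_scale c x + y) \<circ> (endo_scale c x + y) \<in> endo.span C" by metis
    moreover have "linear_endo (endo_scale c x + y)"
      using x y by (intro linear_endo_add linear_endo_scale) auto
    moreover have "graded_endo 1 (endo_scale c x + y)"
      using x y by (intro graded_endo_add graded_endo_scale) auto
    moreover have "endo_scale c x + y \<in> endo.span B"
      by (rule endo.span_add[OF endo.span_scale[OF endo.span_base[OF step(1)]]]) (use y in blast)
    ultimately show ?case by blast
  qed
  then show ?thesis by simp
qed

section \<open>The weight gradation\<close>

lemma lie_element_linear: "lie_element n1 n2 a \<Longrightarrow> linear_endo a"
proof (induction rule: lie_element.induct)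
  case (scale n1 n2 a c)
  show ?case by (rule linear_endo_scale[OF scale.IH])
qed (rule linear_endo_pivot linear_endo_zero linear_endo_add linear_endo_supercomm
    linear_endo_comp; assumption)+

lemma lie_element_weight: "lie_element n1 n2 a \<Longrightarrow> weight_endo (n1 + 2 * n2) a"
proof (induction rule: lie_element.induct)
  case gen0
  show ?case using weight_endo_pivot[of 0] by simp
next
  case gen1
  show ?case using weight_endo_pivot[of 1] by (simp add: numeral_2_eq_2)
next
  case (zero n1 n2)
  show ?case by (rule weight_endo_zero)
next
  case (add n1 n2 a b)
  show ?case by (rule weight_endo_add[OF add.IH])
next
  case (scale n1 n2 a c)
  show ?case by (rule weight_endo_scale[OF scale.IH])
next
  case (bracket n1 n2 a m1 m2 b)
  have "n1 + m1 + 2 * (n2 + m2) = (n1 + 2 * n2) + (m1 + 2 * m2)" by simp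
  then show ?case using weight_endo_supercomm[OF bracket.IH] by (simp only:)
next
  case (square n1 n2 a)
  have "2 * n1 + 2 * (2 * n2) = (n1 + 2 * n2) + (n1 + 2 * n2)" by simp
  then show ?case using weight_endo_comp[OF square.IH square.IH] by metis
qed

lemma lie_element_graded: "lie_element n1 n2 a \<Longrightarrow> graded_endo (n1 + n2) a"
proof (induction rule: lie_element.induct)
  case gen0
  show ?case using graded_endo_pivot[of 0] by simp
next
  case gen1
  show ?case using graded_endo_pivot[of 1] by simp
next
  case (zero n1 n2)
  show ?case by (rule graded_endo_zero)
next
  case (add n1 n2 a b)
  show ?case by (rule graded_endo_add[OF add.IH])
next
  case (scale n1 n2 a c)
  show ?case by (rule graded_endo_scale[OF lie_element_linear[OF scale.hyps] scale.IH])
next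
  case (bracket n1 n2 a m1 m2 b)
  have "graded_endo ((n1 + n2) + (m1 + m2)) (supercomm a b)"
    by (rule graded_endo_supercomm[OF bracket.IH bracket.hyps[THEN lie_element_linear]])
  then show ?case by (simp add: ac_simps)
next
  case (square n1 n2 a)
  have "graded_endo ((n1 + n2) + (n1 + n2)) (a \<circ> a)"
    by (rule graded_endo_comp[OF square.IH square.IH])
  moreover have "2 * n1 + 2 * n2 = (n1 + n2) + (n1 + n2)" by simp
  ultimately show ?case by metis
qed

text \<open>The gradation starts in degree 1, but the rule \<open>zero\<close> also yields Lie
  elements of multidegree \<open>(0, 0)\<close>; these must be trivial.\<close>

lemma lie_element_weight_0: "lie_element n1 n2 a \<Longrightarrow> n1 = 0 \<Longrightarrow> n2 = 0 \<Longrightarrow> a = 0"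
proof (induction rule: lie_element.induct)
  case (add n1 n2 a b)
  then show ?case by (metis add_0)
next
  case (scale n1 n2 a c)
  then have "a = 0" by blast
  then show ?case using endo.scale_zero_right by metis
next
  case (bracket n1 n2 a m1 m2 b)
  then have "n1 = 0" "n2 = 0" "m1 = 0" "m2 = 0" by simp_all
  then have "a = 0" "b = 0" using bracket.IH by blast+
  then show ?case using supercomm_zero(1)[OF linear_endo_zero] by metis
next
  case (square n1 n2 a)
  then have "n1 = 0" "n2 = 0" by simp_all
  then have "a = 0" using square.IH by blast
  then show ?case by (simp add: fun_eq_iff)
qed simp_all

text \<open>A spanning set of \<open>weight_component n\<close> that avoids the intermediate spans
  of the multigraded components.\<close>

definition lie_weight :: "nat \<Rightarrow> 'k::field endo set" where
  "lie_weight n = {w. \<exists>n1 n2. n1 + 2 * n2 = n \<and> lie_element n1 n2 w}"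

lemma lie_weight_linear: "a \<in> lie_weight n \<Longrightarrow> linear_endo a"
  unfolding lie_weight_def by (blast intro: lie_element_linear)

lemma lie_weight_weight: "a \<in> lie_weight n \<Longrightarrow> weight_endo n a"
  unfolding lie_weight_def by (blast intro: lie_element_weight)

lemma lie_weight_graded: "a \<in> lie_weight n \<Longrightarrow> \<exists>p. graded_endo p a"
  unfolding lie_weight_def by (blast intro: lie_element_graded)

lemma lie_weight_supercomm:
  assumes "a \<in> lie_weight m" "b \<in> lie_weight n"
  shows "supercomm a b \<in> lie_weight (m + n)"
proof -
  obtain m1 m2 n1 n2 where *: "m1 + 2 * m2 = m" "lie_element m1 m2 a" "n1 + 2 * n2 = n"
    "lie_element n1 n2 b"
    using assms unfolding lie_weight_def by blast
  have "lie_element (m1 + n1) (m2 + n2) (supercomm a b)"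
    using *(2,4) by (rule lie_element.bracket)
  moreover have "(m1 + n1) + 2 * (m2 + n2) = m + n" using *(1,3) by simp
  ultimately show ?thesis unfolding lie_weight_def by blast
qed

lemma lie_weight_square:
  assumes "CHAR('k) = 2" "a \<in> lie_weight m" "homogeneous 1 a"
  shows "(a :: 'k::field endo) \<circ> a \<in> lie_weight (2 * m)"
proof -
  obtain m1 m2 where *: "m1 + 2 * m2 = m" "lie_element m1 m2 a"
    using assms(2) unfolding lie_weight_def by blast
  have "lie_element (2 * m1) (2 * m2) (a \<circ> a)"
    using assms(1) *(2) assms(3) by (rule lie_element.square)
  moreover have "2 * m1 + 2 * (2 * m2) = 2 * m" using *(1) by simp
  ultimately show ?thesis unfolding lie_weight_def by blast
qed

lemma weight_component_eq: "(weight_component n :: 'k::field endo set) = endo.span (lie_weight n)"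
proof
  have "multi_component n1 n2 \<subseteq> (endo.span (lie_weight n) :: 'k endo set)"
    if "n1 + 2 * n2 = n" for n1 n2
    unfolding multi_component_def
    by (rule endo.span_mono) (use that in \<open>auto simp: lie_weight_def\<close>)
  then have "{w. \<exists>n1 n2. n1 + 2 * n2 = n \<and> w \<in> multi_component n1 n2} \<subseteq>
      (endo.span (lie_weight n) :: 'k endo set)"
    by blast
  then show "(weight_component n :: 'k endo set) \<subseteq> endo.span (lie_weight n)"
    unfolding weight_component_def by (rule endo.span_minimal) (rule endo.subspace_span)
  have "lie_weight n \<subseteq>
      {w :: 'k endo. \<exists>n1 n2. n1 + 2 * n2 = n \<and> w \<in> multi_component n1 n2}"
    unfolding lie_weight_def multi_component_def by (blast intro: endo.span_base)
  then show "(endo.span (lie_weight n) :: 'k endo set) \<subseteq> weight_component n"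
    unfolding weight_component_def by (rule endo.span_mono)
qed

lemma weight_component_supercomm:
  assumes "a \<in> weight_component m" "b \<in> weight_component n"
  shows "supercomm a b \<in> weight_component (m + n)"
  using assms unfolding weight_component_eq
  by (rule supercomm_span)
    (blast intro: lie_weight_linear endo.span_base lie_weight_supercomm)+

lemma graded_endo_cong_mod:
  assumes "graded_endo p a" "p mod 2 = q mod 2"
  shows "graded_endo q a"
  unfolding graded_endo_def
proof (intro allI)
  fix r f
  have "(p + r) mod 2 = (q + r) mod 2" using assms(2) by (metis mod_add_left_eq)
  then show "a (part r f) = part (q + r) (a f)"
    using graded_endoD[OF assms(1)] part_cong_mod by metis
qed

text \<open>The projection \<open>endo_part 1\<close> fixes \<open>a\<close> and the odd elements of
  \<open>A\<close> and kills the even ones, so it discards the even terms of a linear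
  combination.\<close>

lemma homogeneous_span_odd:
  assumes a: "a \<in> endo.span A" "homogeneous 1 a"
    and A: "\<And>x. x \<in> A \<Longrightarrow> linear_endo x" "\<And>x. x \<in> A \<Longrightarrow> \<exists>p. graded_endo p x"
  shows "a \<in> endo.span {x \<in> A. graded_endo 1 x}" (is "_ \<in> ?S")
proof -
  have "endo_part 1 a \<in> ?S" using a(1)
  proof (induction rule: endo.span_induct_alt)
    case base
    show ?case unfolding endo_part_zero by (rule endo.span_zero)
  next
    case (step c x y)
    obtain p where p: "graded_endo p x" using A(2)[OF step(1)] by blast
    have "endo_part 1 x \<in> ?S"
    proof (cases "p mod 2 = 1 mod 2")
      case True
      then have "x \<in> {x \<in> A. graded_endo 1 x}"
        using step(1) graded_endo_cong_mod[OF p] by blast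
      then show ?thesis
        using endo_part_graded[OF p A(1)[OF step(1)], of 1] True endo.span_base by metis
    next
      case False
      then show ?thesis
        using endo_part_graded[OF p A(1)[OF step(1)], of 1] endo.span_zero by metis
    qed
    then show ?case
      unfolding endo_part_add endo_part_scale
      by (rule endo.span_add[OF endo.span_scale step(2)])
  qed
  then show ?thesis using a(2) unfolding homogeneous_def by metis
qed

lemma span_square:
  assumes a: "a \<in> endo.span A" "homogeneous 1 a"
    and A: "\<And>x. x \<in> A \<Longrightarrow> linear_endo x" "\<And>x. x \<in> A \<Longrightarrow> \<exists>p. graded_endo p x"
    and comm: "\<And>x y. x \<in> A \<Longrightarrow> y \<in> A \<Longrightarrow> supercomm x y \<in> endo.span C"
    and sq: "\<And>x. x \<in> A \<Longrightarrow> homogeneous 1 x \<Longrightarrow> x \<circ> x \<in> endo.span C"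
  shows "a \<circ> a \<in> endo.span C"
proof (rule square_span[OF homogeneous_span_odd[OF a A]])
  fix x assume x: "x \<in> {x \<in> A. graded_endo 1 x}"
  then show "linear_endo x" "graded_endo 1 x" using A(1) by blast+
  show "x \<circ> x \<in> endo.span C"
    using x sq graded_imp_homogeneous[of 1 x 1] by blast
  fix y assume "y \<in> {x \<in> A. graded_endo 1 x}"
  then show "supercomm x y \<in> endo.span C" using x comm by blast
qed

lemma weight_component_square:
  assumes "CHAR('k) = 2" "a \<in> weight_component m" "homogeneous 1 a"
  shows "(a :: 'k::field endo) \<circ> a \<in> weight_component (2 * m)"
  using assms(2) unfolding weight_component_eq
proof (rule span_square[OF _ assms(3)])
  fix x y :: "'k endo" assume xy: "x \<in> lie_weight m" "y \<in> lie_weight m"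
  show "supercomm x y \<in> endo.span (lie_weight (2 * m))"
    using lie_weight_supercomm[OF xy] endo.span_base by (metis mult_2)
qed (blast intro: lie_weight_linear lie_weight_graded endo.span_base lie_weight_square assms(1))+

lemma lie_weight_subset_pivot_lie: "lie_weight n \<subseteq> pivot_lie"
proof -
  have "a \<in> pivot_lie" if "lie_element n1 n2 a" for n1 n2 and a :: "'a endo"
    using that unfolding pivot_lie_def
    by (induction rule: lie_element.induct) (blast intro: lie_superalgebra.intros)+
  then show ?thesis unfolding lie_weight_def by blast
qed

lemma pivot_lie_eq: "(pivot_lie :: 'k::field endo set) = endo.span (\<Union>n. lie_weight n)" (is "_ = endo.span ?L")
proof
  have "endo.subspace (pivot_lie :: 'k endo set)"
    unfolding pivot_lie_def endo.subspace_def by (blast intro: lie_superalgebra.intros)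
  then show "endo.span ?L \<subseteq> (pivot_lie :: 'k endo set)"
    using lie_weight_subset_pivot_lie by (intro endo.span_minimal) blast+
  have comm: "supercomm x y \<in> endo.span ?L" if "x \<in> ?L" "y \<in> ?L" for x y :: "'k endo"
  proof (rule endo.span_base)
    show "supercomm x y \<in> ?L" using that lie_weight_supercomm by blast
  qed
  have lin: "linear_endo x" if "x \<in> ?L" for x :: "'k endo"
    using that lie_weight_linear by blast
  have gen: "pivot 0 \<in> lie_weight 1" "pivot 1 \<in> lie_weight 2"
    unfolding lie_weight_def using lie_element.gen0 lie_element.gen1 by force+
  have "a \<in> endo.span ?L" if "a \<in> lie_superalgebra {pivot 0, pivot 1}" for a :: "'k endo"
    using that
  proof (induction rule: lie_superalgebra.induct)
    case (base a)
    then show ?case using gen by (intro endo.span_base) blast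
  next
    case zero
    show ?case by (rule endo.span_zero)
  next
    case (add a b)
    show ?case by (rule endo.span_add[OF add.IH])
  next
    case (scale a c)
    show ?case by (rule endo.span_scale[OF scale.IH])
  next
    case (bracket a b)
    show ?case by (rule supercomm_span[OF bracket.IH lin lin comm])
  next
    case (square a)
    show ?case
    proof (rule span_square[OF square.IH square.hyps(3) lin _ comm])
      fix x :: "'k endo" assume "x \<in> ?L"
      then obtain n where n: "x \<in> lie_weight n" by blast
      show "\<exists>p. graded_endo p x" using n by (rule lie_weight_graded)
      assume "homogeneous 1 x"
      then have "x \<circ> x \<in> lie_weight (2 * n)" by (rule lie_weight_square[OF square.hyps(1) n])
      then show "x \<circ> x \<in> endo.span ?L" by (intro endo.span_base) blast
    qed
  qed
  then show "pivot_lie \<subseteq> endo.span ?L" unfolding pivot_lie_def by blast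
qed

lemma span_weight_components:
  "(endo.span (\<Union>n\<in>{1..}. weight_component n) :: 'k::field endo set) = endo.span (\<Union>n. lie_weight n)"
proof
  have "(weight_component n :: 'k endo set) \<subseteq> endo.span (\<Union>n. lie_weight n)" for n
    unfolding weight_component_eq by (rule endo.span_mono) blast
  then show "(endo.span (\<Union>n\<in>{1..}. weight_component n) :: 'k endo set) \<subseteq> endo.span (\<Union>n. lie_weight n)"
    by (intro endo.span_minimal endo.subspace_span) blast
  have "a \<in> endo.span (\<Union>n\<in>{1..}. weight_component n)" if a: "a \<in> lie_weight n"
    for n and a :: "'k endo"
  \<comment> \<open>The set \<open>lie_weight 0\<close> contains only the zero operator, so its
    absence from the union on the left does no harm.\<close>
  proof (cases "n = 0")
    case True
    then have "a = 0" using a lie_element_weight_0 unfolding lie_weight_def by fastforce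
    then show ?thesis using endo.span_zero by metis
  next
    case False
    then show ?thesis
      using a endo.span_base[of a "lie_weight n"]
      by (intro endo.span_base) (auto simp: weight_component_eq)
  qed
  then show "(endo.span (\<Union>n. lie_weight n) :: 'k endo set) \<subseteq> endo.span (\<Union>n\<in>{1..}. weight_component n)"
    by (intro endo.span_minimal endo.subspace_span) blast
qed

lemma lie_gradation_pivot_lie: "lie_gradation (pivot_lie :: 'k::field endo set) weight_component"
  unfolding lie_gradation_def
proof (intro conjI allI impI ballI)
  show "endo.subspace (weight_component n)" for n
    unfolding weight_component_eq by (rule endo.subspace_span)
  show "(pivot_lie :: 'k endo set) = endo.span (\<Union>n\<in>{1..}. weight_component n)"
    by (simp only: pivot_lie_eq span_weight_components)
  show "supercomm a b \<in> weight_component (m + n)"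
    if "a \<in> weight_component m" "b \<in> weight_component n" for m n and a b :: "'k endo"
    using that by (rule weight_component_supercomm)
  show "a \<circ> a \<in> weight_component (2 * n)"
    if "CHAR('k) = 2" "a \<in> weight_component n" "homogeneous 1 a" for n and a :: "'k endo"
    using that by (rule weight_component_square)
  fix N :: "nat set" and w :: "nat \<Rightarrow> 'k endo" and n
  assume *: "finite N" "\<forall>n\<in>N. w n \<in> weight_component n" "(\<Sum>n\<in>N. w n) = 0" "n \<in> N"
  have w: "linear_endo (w n)" "weight_endo n (w n)" if "n \<in> N" for n
    using *(2) that linear_endo_span weight_endo_span lie_weight_linear lie_weight_weight
    unfolding weight_component_eq by blast+
  show "w n = 0" by (rule weight_endo_independent[OF *(1) w *(3,4)])
qed

section \<open>Supercommutators of monomial multiples of pivot elements\<close>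

definition mult_pivot :: "'k::comm_ring_1 grassmann \<Rightarrow> nat \<Rightarrow> 'k endo" where
  "mult_pivot g n = (\<lambda>f. g * pivot n f)"

lemma linear_endo_mult_pivot: "linear_endo (mult_pivot g n)"
  unfolding mult_pivot_def
  by (intro linear_endoI) (simp_all add: pivot_add pivot_scale distrib_left scale_mult)

lemma graded_endo_mult_pivot:
  assumes "part p g = g"
  shows "graded_endo (Suc p) (mult_pivot g n)"
  using part_mult[OF assms] by (simp add: graded_endo_def mult_pivot_def pivot_part flip: add_Suc_right)

lemma mult_pivot_scale: "mult_pivot (scale c g) n = endo_scale c (mult_pivot g n)"
  by (simp add: mult_pivot_def endo_scale_def scale_mult)

text \<open>The first-order terms come from differentiating the coefficients \<open>h\<close> and
  \<open>g\<close>. In the second-order terms the coefficients are brought into the same order, and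
  the signs combine to the anticommutator of the pivot elements.\<close>

lemma supercomm_mult_pivot:
  fixes g h :: "'k::comm_ring_1 grassmann"
  assumes g: "part p g = g" and h: "part q h = h"
  shows "supercomm (mult_pivot g n) (mult_pivot h m) f =
    g * (pivot n h * pivot m f) - scale ((-1) ^ (Suc p * Suc q)) (h * (pivot m g * pivot n f)) +
    scale ((-1) ^ q) (g * (h * (pivot n (pivot m f) + pivot m (pivot n f))))"
proof -
  have hg: "h * (g * x) = scale ((-1) ^ (p * q)) (g * (h * x))" for x
    using mult_supercommute[OF h g] by (simp add: scale_mult mult.commute flip: mult.assoc)
  have sign: "(-1) ^ (Suc p * Suc q) * ((-1) ^ p * (-1) ^ (p * q)) = (- ((-1) ^ q) :: 'k)"
    by (cases "even p"; cases "even q") (simp_all add: minus_one_power_iff)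
  have "scale ((-1) ^ (Suc p * Suc q)) (h * pivot m (g * pivot n f)) =
      scale ((-1) ^ (Suc p * Suc q)) (h * (pivot m g * pivot n f)) +
      scale ((-1) ^ (Suc p * Suc q) * ((-1) ^ p * (-1) ^ (p * q))) (g * (h * pivot m (pivot n f)))"
    by (simp only: pivot_leibniz[OF g] distrib_left scale_mult scale_simps hg mult.assoc)
  also have "\<dots> = scale ((-1) ^ (Suc p * Suc q)) (h * (pivot m g * pivot n f)) -
      scale ((-1) ^ q) (g * (h * pivot m (pivot n f)))"
    unfolding sign by simp
  finally have 2: "scale ((-1) ^ (Suc p * Suc q)) (h * pivot m (g * pivot n f)) =
      scale ((-1) ^ (Suc p * Suc q)) (h * (pivot m g * pivot n f)) -
      scale ((-1) ^ q) (g * (h * pivot m (pivot n f)))" .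
  have 1: "g * pivot n (h * pivot m f) =
      g * (pivot n h * pivot m f) + scale ((-1) ^ q) (g * (h * pivot n (pivot m f)))"
    by (simp only: pivot_leibniz[OF h] distrib_left scale_mult)
  have "supercomm (mult_pivot g n) (mult_pivot h m) f =
      g * pivot n (h * pivot m f) - scale ((-1) ^ (Suc p * Suc q)) (h * pivot m (g * pivot n f))"
    using supercomm_graded[OF graded_endo_mult_pivot[OF g] graded_endo_mult_pivot[OF h]
        linear_endo_mult_pivot linear_endo_mult_pivot]
    by (simp add: mult_pivot_def)
  then show ?thesis
    unfolding 1 2 by (simp add: distrib_left)
qed

lemma supercomm_swap:
  assumes "graded_endo p a" "graded_endo q b" "linear_endo a" "linear_endo b"
  shows "supercomm b a = endo_scale (- ((-1) ^ (p * q))) (supercomm a b)"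
proof
  fix f
  have "(-1) ^ (p * q) * (-1) ^ (p * q) = (1 :: 'a)" by (simp flip: power_mult_distrib)
  then show "supercomm b a f = endo_scale (- ((-1) ^ (p * q))) (supercomm a b) f"
    using supercomm_graded[OF assms, of f] supercomm_graded[OF assms(2,1,4,3), of f]
    by (simp add: endo_apply(4) mult.commute)
qed

lemma pderiv_monomial: "finite A \<Longrightarrow> i \<notin> A \<Longrightarrow> pderiv i (monomial A) = 0"
  by (rule grassmann_eqI) (auto simp: coeff_pderiv coeff_monomial coeff_simps)

lemma pivot_monomial_0: "A \<subseteq> {..<m} \<Longrightarrow> pivot m (monomial A) = 0"
  by (rule pivot_eq_0, rule pderiv_monomial) (auto intro: finite_subset)

lemma monomial_mult_cases:
  assumes "finite A" "finite B"
  obtains c where "monomial A * monomial B = scale c (monomial (A \<union> B))" "c = 0 \<or> A \<inter> B = {}"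
  using monomial_mult[OF assms] by (cases "A \<inter> B = {}") (auto intro: that[of 0] that)

text \<open>Since \<open>pivot n\<close> has weight \<open>2 ^ n\<close>, only the set whose code is
  \<open>2 ^ n\<close> below that of \<open>B\<close> can occur in the result.\<close>

lemma pivot_monomial_cases:
  assumes B: "finite B"
  obtains c C where "finite C" "pivot n (monomial B) = scale c (monomial C)"
    "c = 0 \<or> set_encode C + 2 ^ n = set_encode B"
proof -
  have nz: "coeff (pivot n (monomial B)) T = 0"
    if "finite T" "set_encode T + 2 ^ n \<noteq> set_encode B" for T
  proof -
    obtain S where S: "finite S" "set_encode S = set_encode T + 2 ^ n" by (rule set_encode_shift)
    then have "S \<noteq> B" using that by auto
    then have "coeff (monomial B) S = coeff 0 S" using B by (simp add: coeff_monomial coeff_simps)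
    then show ?thesis
      using weight_endoD[OF weight_endo_pivot S(1) that(1) S(2), of "monomial B" 0]
      by (simp add: coeff_simps)
  qed
  show thesis
  proof (cases "2 ^ n \<le> set_encode B")
    case True
    obtain C where C: "finite C" "set_encode C = set_encode B - 2 ^ n" by (rule set_encode_shift)
    have "pivot n (monomial B) = scale (coeff (pivot n (monomial B)) C) (monomial C)"
    proof (rule grassmann_eqI)
      fix T :: "nat set" assume T: "finite T"
      show "coeff (pivot n (monomial B)) T =
        coeff (scale (coeff (pivot n (monomial B)) C) (monomial C)) T"
      proof (cases "T = C")
        case True
        then show ?thesis using C by (simp add: scale.rep_eq coeff_monomial)
      next
        case False
        then have "set_encode T \<noteq> set_encode C" using set_encode_eq[OF T C(1)] by simp
        then have "set_encode T + 2 ^ n \<noteq> set_encode B" using C(2) by simp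
        then show ?thesis using nz[OF T] False C(1) by (simp add: scale.rep_eq coeff_monomial)
      qed
    qed
    then show thesis by (rule that[OF C(1)]) (use C(2) True in simp)
  next
    case False
    then have "pivot n (monomial B) = scale 0 (monomial {})"
      by (intro grassmann_eqI) (simp add: nz coeff_simps)
    then show thesis by (rule that[rotated]) simp_all
  qed
qed

section \<open>Binary codes of finite sets\<close>

lemma set_encode_union:
  assumes "finite A" "finite B" "A \<inter> B = {}"
  shows "set_encode (A \<union> B) = set_encode A + set_encode B"
  using assms by (simp add: set_encode_def sum.union_disjoint)

lemma set_encode_interval: "n \<le> m \<Longrightarrow> set_encode {n..<m} + 2 ^ n = 2 ^ m"
proof (induction m rule: dec_induct)
  case (step m)
  then have "{n..<Suc m} = insert m {n..<m}" by auto
  then show ?case using step by simp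
qed simp

lemma set_encode_less:
  assumes "A \<subseteq> {..<m}"
  shows "set_encode A < 2 ^ m"
proof -
  have "set_encode A \<le> set_encode {..<m}"
    unfolding set_encode_def by (rule sum_mono2) (use assms in auto)
  moreover have "set_encode {..<m} + 1 = 2 ^ m"
    using set_encode_interval[of 0 m] by (simp add: atLeast0LessThan)
  ultimately show ?thesis by linarith
qed

lemma set_decode_subset:
  assumes "a < 2 ^ m"
  shows "set_decode a \<subseteq> {..<m}"
proof
  fix i assume i: "i \<in> set_decode a"
  show "i \<in> {..<m}"
  proof (rule ccontr)
    assume "i \<notin> {..<m}"
    then have "2 ^ m \<le> (2 ^ i :: nat)" by simp
    then have "a < 2 ^ i" using assms by linarith
    then have "a div 2 ^ i = 0" by (rule div_less)
    then show False using i by (simp add: set_decode_def)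
  qed
qed

text \<open>
  The element \<open>x_A v_m\<close> of weight \<open>w\<close>: necessarily \<open>A\<close> has the code \<open>2 ^ m - w\<close>. The indices
  \<open>m\<close> which occur for a given \<open>w\<close> are those with \<open>A \<subseteq> {0, \<dots>, m - 2}\<close> or
  \<open>m - 1 \<in> A \<subseteq> {0, \<dots>, m - 3} \<union> {m - 1}\<close>, apart from \<open>x_0 v_1\<close> and \<open>x_0 x_2 v_3\<close>.
\<close>

definition weight_elem :: "nat \<Rightarrow> nat \<Rightarrow> 'k::comm_ring_1 endo" where
  "weight_elem w m = mult_pivot (monomial (set_decode (2 ^ m - w))) m"

definition weight_indices :: "nat \<Rightarrow> nat set" where
  "weight_indices w = {m. w \<le> 2 ^ m \<and> 2 ^ m < 4 * w \<and> (w, m) \<noteq> (1, 1) \<and> (w, m) \<noteq> (3, 3)}"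

lemma mult_pivot_monomial_eq:
  assumes "finite A" "set_encode A + w = 2 ^ m"
  shows "mult_pivot (monomial A) m = weight_elem w m"
proof -
  have "2 ^ m - w = set_encode A" using assms(2) by simp
  then show ?thesis using set_encode_inverse[OF assms(1)] by (simp add: weight_elem_def)
qed

lemma weight_elem_span:
  "m \<in> weight_indices w \<Longrightarrow> weight_elem w m \<in> endo.span (weight_elem w ` weight_indices w)"
  by (rule endo.span_base) blast

lemma endo_scale_0 [simp]: "endo_scale 0 a = 0"
  by (simp add: fun_eq_iff endo_apply(4))

text \<open>As \<open>n \<le> m\<close>, \<open>v_m\<close> annihilates \<open>x_A\<close>. There
  remain the term with \<open>v_n\<close> applied to \<open>x_B\<close>, which keeps the index
  \<open>m\<close>, and the anticommutator term, whose index is \<open>m + 1\<close> or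
  \<open>m + 2\<close>. Additivity of weights determines the letters.\<close>

lemma supercomm_weight_elem_le:
  assumes "n \<le> m" and n: "n \<in> weight_indices u" and m: "m \<in> weight_indices w"
  shows "supercomm (weight_elem u n) (weight_elem w m :: 'k::field endo) \<in>
    endo.span (weight_elem (u + w) ` weight_indices (u + w))" (is "_ \<in> ?V")
proof -
  define A where "A = set_decode (2 ^ n - u)"
  define B where "B = set_decode (2 ^ m - w)"
  have u: "u \<le> 2 ^ n" "2 ^ n < 4 * u" "(u, n) \<noteq> (1, 1)" "(u, n) \<noteq> (3, 3)" "0 < u"
    and w: "w \<le> 2 ^ m" "2 ^ m < 4 * w" "(w, m) \<noteq> (1, 1)" "(w, m) \<noteq> (3, 3)" "0 < w"
    using n m unfolding weight_indices_def by (auto intro: gr0I)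
  have A: "finite A" "A \<subseteq> {..<n}" "set_encode A + u = 2 ^ n"
    and B: "finite B" "B \<subseteq> {..<m}" "set_encode B + w = 2 ^ m"
    using u w by (auto simp: A_def B_def set_decode_inverse intro!: set_decode_subset)
  define T where "T = (\<lambda>f. pivot n (pivot m f) + pivot m (pivot n f) :: 'k grassmann)"
  obtain c C where C: "finite C" "pivot n (monomial B) = scale c (monomial C :: 'k grassmann)"
    "c = 0 \<or> set_encode C + 2 ^ n = set_encode B"
    using pivot_monomial_cases[OF B(1)] by metis
  obtain d where d: "monomial A * monomial C = scale d (monomial (A \<union> C) :: 'k grassmann)"
    "d = 0 \<or> A \<inter> C = {}"
    using monomial_mult_cases[OF A(1) C(1)] by metis
  have "pivot m (monomial A) = (0 :: 'k grassmann)"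
    by (rule pivot_monomial_0) (use A(2) assms(1) in auto)
  then have eq: "supercomm (weight_elem u n) (weight_elem w m) =
      endo_scale (c * d) (mult_pivot (monomial (A \<union> C)) m) +
      endo_scale ((-1) ^ card B) (\<lambda>f. monomial A * (monomial B * T f) :: 'k grassmann)"
    using supercomm_mult_pivot[OF part_monomial[OF A(1)] part_monomial[OF B(1)], where 'k = 'k] d(1) C(2)
    by (simp add: fun_eq_iff weight_elem_def A_def[symmetric] B_def[symmetric] T_def endo_apply(4)
        mult_pivot_def scale_mult flip: mult.assoc)
  have 1: "endo_scale (c * d) (mult_pivot (monomial (A \<union> C)) m) \<in> ?V"
  proof (cases "c = 0 \<or> d = 0")
    case True
    then show ?thesis using endo.span_zero by auto
  next
    case False
    then have *: "set_encode (A \<union> C) + (u + w) = 2 ^ m"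
      using C d set_encode_union[OF A(1) C(1)] A(3) B(3) by simp
    have "mult_pivot (monomial (A \<union> C)) m = (weight_elem (u + w) m :: 'k endo)"
      by (rule mult_pivot_monomial_eq[OF _ *]) (use A(1) C(1) in simp)
    \<comment> \<open>The bound \<open>2 ^ m < 4 * w\<close> persists for \<open>u + w\<close>. The
      exceptional pairs are avoided since \<open>u + w \<ge> 2\<close>, and since
      \<open>m = 3\<close> forces \<open>w \<ge> 3\<close>, hence
      \<open>u + w \<ge> 4\<close>.\<close>
    moreover have "m \<in> weight_indices (u + w)"
      using * u(5) w(2,5) unfolding weight_indices_def by auto
    ultimately show ?thesis using endo.span_scale[OF weight_elem_span] by metis
  qed
  \<comment> \<open>If the anticommutator term survives, \<open>A\<close> and \<open>B\<close> are
    disjoint subsets of \<open>{..<n}\<close>. Their codes then add up to less than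
    \<open>2 ^ n\<close>, and subtracting them from \<open>2 ^ n + 2 ^ m\<close> gives
    \<open>u + w\<close>.\<close>
  have small: "2 ^ m < u + w" if "B \<inter> {n..<m} = {}" "A \<inter> B = {}"
  proof -
    have "A \<union> B \<subseteq> {..<n}" using A(2) B(2) that(1) by fastforce
    then have "set_encode A + set_encode B < 2 ^ n"
      using set_encode_less set_encode_union[OF A(1) B(1) that(2)] by metis
    then show ?thesis using A(3) B(3) by linarith
  qed
  \<comment> \<open>Common to both parities of \<open>m - n\<close>: the anticommutator has
    coefficient \<open>e\<close>, letters \<open>E\<close> and pivot index \<open>k\<close>.\<close>
  have 2: "(\<lambda>f. monomial A * (monomial B * T f)) \<in> ?V"
    if E: "finite E" "{n..<m} \<subseteq> E" "E \<inter> {..<n} = {}" "\<And>f. T f = scale e (monomial E * pivot k f)"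
      "set_encode E + 2 ^ n + 2 ^ m = 2 ^ k" and k: "2 ^ m < u + w \<Longrightarrow> k \<in> weight_indices (u + w)"
    for E e k
  proof -
    obtain d1 where d1: "monomial A * monomial B = scale d1 (monomial (A \<union> B) :: 'k grassmann)"
      "d1 = 0 \<or> A \<inter> B = {}"
      using monomial_mult_cases[OF A(1) B(1)] by metis
    obtain d2 where d2: "monomial (A \<union> B) * monomial E = scale d2 (monomial (A \<union> B \<union> E) :: 'k grassmann)"
      "d2 = 0 \<or> (A \<union> B) \<inter> E = {}"
      using monomial_mult_cases[of "A \<union> B" E] A(1) B(1) E(1) by blast
    have "monomial A * monomial B * monomial E = scale (d1 * d2) (monomial (A \<union> B \<union> E) :: 'k grassmann)"
      by (simp only: d1(1) d2(1) scale_mult scale_simps)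
    then have "monomial A * (monomial B * (monomial E * x)) =
        scale (d1 * d2) (monomial (A \<union> B \<union> E) * x)" for x :: "'k grassmann"
      by (metis mult.assoc scale_mult(1))
    then have "monomial A * (monomial B * T f) =
        scale (e * (d1 * d2)) (monomial (A \<union> B \<union> E) * pivot k f)" for f
      by (simp only: E(4) scale_mult scale_simps)
    then have eq: "(\<lambda>f. monomial A * (monomial B * T f)) =
        endo_scale (e * (d1 * d2)) (mult_pivot (monomial (A \<union> B \<union> E)) k)"
      by (simp add: fun_eq_iff endo_apply(4) mult_pivot_def)
    show ?thesis
    proof (cases "d1 = 0 \<or> d2 = 0")
      case True
      then show ?thesis unfolding eq using endo.span_zero by auto
    next
      case False
      then have disj: "A \<inter> B = {}" "(A \<union> B) \<inter> E = {}" using d1 d2 by auto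
      then have "k \<in> weight_indices (u + w)" using E(2) by (intro k small) auto
      moreover have *: "set_encode (A \<union> B \<union> E) + (u + w) = 2 ^ k"
        using set_encode_union[OF _ E(1) disj(2)] set_encode_union[OF A(1) B(1) disj(1)]
          A(1,3) B(1,3) E(5) by simp
      moreover have "mult_pivot (monomial (A \<union> B \<union> E)) k = (weight_elem (u + w) k :: 'k endo)"
        by (rule mult_pivot_monomial_eq[OF _ *]) (use A(1) B(1) E(1) in simp)
      ultimately show ?thesis unfolding eq using endo.span_scale[OF weight_elem_span] by metis
    qed
  qed
  have "(\<lambda>f. monomial A * (monomial B * T f)) \<in> ?V"
  proof (cases "even (m - n)")
    case True
    then obtain j where j: "m = n + 2 * j" using assms(1) by (metis evenE le_add_diff_inverse)
    show ?thesis
    proof (rule 2[of "insert (m + 1) {n..<m}" 2 "m + 2"])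
      show "T f = scale 2 (monomial (insert (m + 1) {n..<m}) * pivot (m + 2) f)" for f
        using pivot_anticommutator_even[of n j f] by (simp add: T_def j)
      show "set_encode (insert (m + 1) {n..<m}) + 2 ^ n + 2 ^ m = 2 ^ (m + 2)"
        using set_encode_interval[OF assms(1)] by simp
      assume *: "2 ^ m < u + w"
      \<comment> \<open>The pair \<open>(3, 3)\<close> would force \<open>m = n = 1\<close>, where
        the only admissible weights are \<open>u = w = 2\<close>, with sum 4.\<close>
      have "(u + w, m + 2) \<noteq> (3, 3)"
      proof
        assume **: "(u + w, m + 2) = (3, 3)"
        then have "m = 1" by simp
        then have "n = 1" using j by presburger
        then show False using ** \<open>m = 1\<close> u(1,2,3) w(1,2,3) by auto
      qed
      moreover have "u + w \<le> 2 ^ (m + 2)"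
      proof -
        have "2 ^ n \<le> (2 ^ m :: nat)" using assms(1) by simp
        moreover have "2 ^ (m + 2) = 4 * (2 ^ m :: nat)" by simp
        ultimately show ?thesis using u(1) w(1) by linarith
      qed
      ultimately show "m + 2 \<in> weight_indices (u + w)"
        using * unfolding weight_indices_def by auto
    qed (use assms(1) in auto)
  next
    case False
    then obtain j where "m - n = 2 * j + 1" by (rule oddE)
    then have j: "m = n + 2 * j + 1" using assms(1) by simp
    show ?thesis
    proof (rule 2[of "{n..<m}" "- 1" "m + 1"])
      show "T f = scale (- 1) (monomial {n..<m} * pivot (m + 1) f)" for f
        using pivot_anticommutator_odd[of n j f] by (simp add: T_def j)
      show "set_encode {n..<m} + 2 ^ n + 2 ^ m = 2 ^ (m + 1)"
        using set_encode_interval[OF assms(1)] by simp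
      assume *: "2 ^ m < u + w"
      have "u + w \<le> 2 ^ (m + 1)"
      proof -
        have "2 ^ n \<le> (2 ^ m :: nat)" using assms(1) by simp
        moreover have "2 ^ (m + 1) = 2 * (2 ^ m :: nat)" by simp
        ultimately show ?thesis using u(1) w(1) by linarith
      qed
      \<comment> \<open>For \<open>m = 2\<close> the sum \<open>u + w\<close> already exceeds
        4.\<close>
      moreover have "(u + w, m + 1) \<noteq> (3, 3)" using * by auto
      moreover have "u + w \<noteq> 1" using u(5) w(5) by simp
      ultimately show "m + 1 \<in> weight_indices (u + w)"
        using * unfolding weight_indices_def by auto
    qed auto
  qed
  then show ?thesis unfolding eq by (intro endo.span_add 1 endo.span_scale)
qed

lemma weight_elem_linear: "linear_endo (weight_elem w m)"
  unfolding weight_elem_def by (rule linear_endo_mult_pivot)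

lemma weight_elem_graded: "\<exists>p. graded_endo p (weight_elem w m)"
  unfolding weight_elem_def by (meson graded_endo_mult_pivot part_monomial finite_set_decode)

lemma supercomm_weight_elem:
  assumes n: "n \<in> weight_indices u" and m: "m \<in> weight_indices w"
  shows "supercomm (weight_elem u n) (weight_elem w m :: 'k::field endo) \<in>
    endo.span (weight_elem (u + w) ` weight_indices (u + w))"
proof (cases "n \<le> m")
  case True
  then show ?thesis by (rule supercomm_weight_elem_le[OF _ n m])
next
  case False
  then have "supercomm (weight_elem w m) (weight_elem u n :: 'k endo) \<in>
      endo.span (weight_elem (w + u) ` weight_indices (w + u))"
    by (intro supercomm_weight_elem_le m n) simp
  moreover obtain p q where "graded_endo p (weight_elem w m :: 'k endo)"
    "graded_endo q (weight_elem u n :: 'k endo)"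
    using weight_elem_graded by metis
  ultimately show ?thesis
    using supercomm_swap[OF _ _ weight_elem_linear weight_elem_linear]
    by (metis add.commute endo.span_scale)
qed

lemma lie_element_in_span:
  "lie_element n1 n2 (a :: 'k::field endo) \<Longrightarrow> CHAR('k) \<noteq> 2 \<Longrightarrow>
    a \<in> endo.span (weight_elem (n1 + 2 * n2) ` weight_indices (n1 + 2 * n2))"
proof (induction rule: lie_element.induct)
  case gen0
  have "pivot 0 = (weight_elem 1 0 :: 'k endo)" by (simp add: weight_elem_def mult_pivot_def)
  moreover have "0 \<in> weight_indices 1" by (simp add: weight_indices_def)
  ultimately show ?case using weight_elem_span[of 0 1] by simp
next
  case gen1
  have "pivot 1 = (weight_elem 2 1 :: 'k endo)" by (simp add: weight_elem_def mult_pivot_def)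
  moreover have "1 \<in> weight_indices 2" by (simp add: weight_indices_def)
  ultimately show ?case using weight_elem_span[of 1 2] by (simp add: numeral_2_eq_2)
next
  case (zero n1 n2)
  show ?case by (rule endo.span_zero)
next
  case (add n1 n2 a b)
  show ?case by (rule endo.span_add[OF add.IH[OF add.prems]])
next
  case (scale n1 n2 a c)
  show ?case by (rule endo.span_scale[OF scale.IH[OF scale.prems]])
next
  case (bracket n1 n2 a m1 m2 b)
  have "supercomm a b \<in> endo.span (weight_elem ((n1 + 2 * n2) + (m1 + 2 * m2)) `
      weight_indices ((n1 + 2 * n2) + (m1 + 2 * m2)))"
    by (rule supercomm_span[OF bracket.IH(1)[OF bracket.prems] bracket.IH(2)[OF bracket.prems]])
      (auto intro: weight_elem_linear supercomm_weight_elem)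
  moreover have "n1 + m1 + 2 * (n2 + m2) = (n1 + 2 * n2) + (m1 + 2 * m2)" by simp
  ultimately show ?case by metis
next
  case (square n1 n2 a)
  \<comment> \<open>The rule \<open>square\<close> requires characteristic 2, which is
    excluded.\<close>
  then show ?case by blast
qed

section \<open>Generation and dimensions\<close>

lemma weight_component_scale: "a \<in> weight_component w \<Longrightarrow> endo_scale c a \<in> weight_component w"
  unfolding weight_component_eq by (rule endo.span_scale)

lemma weight_component_scaleD:
  assumes "endo_scale c a \<in> weight_component w" "c \<noteq> 0"
  shows "a \<in> weight_component w"
proof -
  have "endo_scale (inverse c) (endo_scale c a) = a"
    using assms(2) by (simp add: fun_eq_iff endo_apply(4))
  then show ?thesis using weight_component_scale[OF assms(1), of "inverse c"] by simp
qed

lemma supercomm_pivot: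
  "supercomm (pivot n) (pivot m) f = pivot n (pivot m f) + pivot m (pivot n f)"
  using supercomm_graded[OF graded_endo_pivot graded_endo_pivot linear_endo_pivot linear_endo_pivot]
  by simp

text \<open>Divisibility by \<open>x_j\<close> makes the anticommutator vanish after multiplication
  by \<open>x_j\<close>.\<close>

lemma pivot_anticommutator_left_factor:
  assumes "j < n"
  obtains h where "pivot j (pivot n f) + pivot n (pivot j f) = gen j * h"
proof (cases "n = Suc j")
  case True
  then show ?thesis
    using pivot_anticommutator_Suc[of j f] that[of "- pivot (Suc (Suc j)) f"] by simp
next
  case False
  then show ?thesis using pivot_anticommutator_step[of j n f] that assms by simp
qed

lemma pivot_one: "pivot n 1 = 0"
  using pivot_monomial_0[of "{}" n] by simp

lemma part_one: "part 0 1 = 1"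
  using part_monomial[of "{}"] by simp

lemma mult_pivot_one: "mult_pivot 1 n = pivot n"
  by (simp add: mult_pivot_def)

lemma gen_mult_gen_0:
  fixes g :: "'k::comm_ring_1 grassmann"
  assumes "part q g = g"
  shows "gen j * (g * (gen j * h)) = 0"
proof -
  have "gen j * (g * (gen j * h)) = gen j * ((g * gen j) * h)" by (simp only: mult.assoc)
  also have "g * gen j = scale ((-1) ^ (q * 1)) (gen j * g)"
    by (rule mult_supercommute) (use assms in simp_all)
  finally show ?thesis by (simp add: scale_mult mult.assoc)
qed

text \<open>As \<open>\<partial>_j g = 0\<close>, what is left of \<open>v_j g\<close> starts with
  \<open>x_j\<close>, so \<open>v_j\<close> turns \<open>x_j g\<close> into \<open>g\<close>. The
  second-order term contains \<open>x_j\<close> twice and vanishes.\<close>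

lemma supercomm_pivot_remove_gen:
  fixes g :: "'k::comm_ring_1 grassmann"
  assumes g: "part q g = g" "pderiv j g = 0" and j: "j < n"
  shows "supercomm (pivot j) (mult_pivot (gen j * g) n) = mult_pivot g n"
proof
  fix f :: "'k grassmann"
  obtain h where h: "pivot j (pivot n f) + pivot n (pivot j f) = gen j * h"
    using pivot_anticommutator_left_factor[OF j] .
  have "part (Suc q) (gen j * g) = gen j * g"
    using part_gen_mult[of q j g] g(1) by simp
  note formula = supercomm_mult_pivot[OF part_one this, of j n f]
  have "gen j * pivot j g = 0" using pivot_step[of j g] g(2) by simp
  then have "pivot j (gen j * g) = g" by (simp add: pivot_gen_mult pivot_gen_self)
  then show "supercomm (pivot j) (mult_pivot (gen j * g) n) f = mult_pivot g n f"
    using formula gen_mult_gen_0[OF g(1), of j h]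
    by (simp add: h mult_pivot_one pivot_one mult.assoc) (simp add: mult_pivot_def)
qed

text \<open>Up to sign, the bracket of \<open>v_k\<close> and \<open>v_{k+1}\<close> is
  \<open>x_k v_{k+2}\<close>, and a further bracket with \<open>v_k\<close> removes the
  letter.\<close>

lemma pivot_in_weight_component: "(pivot n :: 'k::field endo) \<in> weight_component (2 ^ n)"
proof (induction n rule: less_induct)
  case (less n)
  consider "n = 0" | "n = 1" | k where "n = Suc (Suc k)" by (metis One_nat_def not0_implies_Suc)
  then show ?case
  proof cases
    case 1
    have "(pivot 0 :: 'k endo) \<in> lie_weight 1"
      unfolding lie_weight_def using lie_element.gen0 by force
    then show ?thesis unfolding weight_component_eq 1 by (intro endo.span_base) simp
  next
    case 2
    have "(pivot 1 :: 'k endo) \<in> lie_weight 2"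
      unfolding lie_weight_def using lie_element.gen1 by force
    then show ?thesis unfolding weight_component_eq 2 by (intro endo.span_base) simp
  next
    case 3
    have "supercomm (pivot k) (pivot (Suc k)) = (endo_scale (- 1) (mult_pivot (gen k) n) :: 'k endo)"
      unfolding 3
      by (simp add: fun_eq_iff supercomm_pivot pivot_anticommutator_Suc endo_apply(4) mult_pivot_def)
    then have "(mult_pivot (gen k * 1) n :: 'k endo) \<in> weight_component (2 ^ k + 2 ^ Suc k)"
      using weight_component_supercomm[OF less.IH[of k] less.IH[of "Suc k"]] 3
        weight_component_scaleD[of "- 1"] by force
    then have "supercomm (pivot k) (mult_pivot (gen k * 1) n :: 'k endo) \<in>
        weight_component (2 ^ k + (2 ^ k + 2 ^ Suc k))"
      using less.IH[of k] 3 by (intro weight_component_supercomm) simp_all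
    moreover have "supercomm (pivot k) (mult_pivot (gen k * 1) n) = (pivot n :: 'k endo)"
      using supercomm_pivot_remove_gen[OF part_one, of k n, where 'k = 'k]
        pderiv_monomial[of "{}" k, where 'a = 'k] 3 by (simp add: mult_pivot_one)
    moreover have "2 ^ k + (2 ^ k + 2 ^ Suc k) = (2 ^ n :: nat)" using 3 by simp
    ultimately show ?thesis by metis
  qed
qed

lemma remove_letter:
  assumes A: "finite A" "j \<notin> A" and j: "j < n"
    and mem: "(mult_pivot (monomial (insert j A)) n :: 'k::field endo) \<in> weight_component w"
  shows "(mult_pivot (monomial A) n :: 'k endo) \<in> weight_component (2 ^ j + w)"
proof -
  have "gen j * monomial A = scale (inv_sign {j} A) (monomial (insert j A) :: 'k grassmann)"
    using monomial_mult[of "{j}" A, where 'a = 'k] A by (simp add: monomial_singleton)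
  then have "(mult_pivot (gen j * monomial A) n :: 'k endo) \<in> weight_component w"
    using weight_component_scale[OF mem] by (simp add: mult_pivot_scale)
  then have "supercomm (pivot j) (mult_pivot (gen j * monomial A) n :: 'k endo) \<in>
      weight_component (2 ^ j + w)"
    by (intro weight_component_supercomm pivot_in_weight_component)
  then show ?thesis
    using supercomm_pivot_remove_gen[OF part_monomial[OF A(1)] pderiv_monomial[OF A] j, where 'k = 'k]
    by simp
qed

lemma remove_letters:
  assumes D: "finite D" "D \<subseteq> {..<n}" "A \<inter> D = {}" "finite A"
    and "(mult_pivot (monomial (A \<union> D)) n :: 'k::field endo) \<in> weight_component w"
  shows "(mult_pivot (monomial A) n :: 'k endo) \<in> weight_component (set_encode D + w)"
  using assms
proof (induction D arbitrary: w rule: finite_induct)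
  case empty
  then show ?case by simp
next
  case (insert j D)
  have "(mult_pivot (monomial (A \<union> D)) n :: 'k endo) \<in> weight_component (2 ^ j + w)"
    by (rule remove_letter) (use insert in auto)
  then have "(mult_pivot (monomial A) n :: 'k endo) \<in> weight_component (set_encode D + (2 ^ j + w))"
    using insert by (intro insert.IH) auto
  then show ?case using insert.hyps by (simp add: ac_simps)
qed

text \<open>Letters of \<open>B\<close> outside \<open>A\<close> are removed one at a time by
  brackets with the pivot elements of the same index, so generating maximal monomials
  suffices.\<close>

lemma sub_monomial_in_weight_component:
  assumes "(mult_pivot (monomial B) n :: 'k::field endo) \<in> weight_component (2 ^ n - set_encode B)"
    and "A \<subseteq> B" "B \<subseteq> {..<n}"
  shows "(mult_pivot (monomial A) n :: 'k endo) \<in> weight_component (2 ^ n - set_encode A)"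
proof -
  have fin: "finite A" "finite (B - A)" "A \<union> (B - A) = B"
    using assms by (auto intro: finite_subset)
  then have "(mult_pivot (monomial A) n :: 'k endo) \<in>
      weight_component (set_encode (B - A) + (2 ^ n - set_encode B))"
    using assms by (intro remove_letters) auto
  moreover have "set_encode B = set_encode A + set_encode (B - A)"
    using set_encode_union[OF fin(1,2)] fin(3) by auto
  then have "set_encode (B - A) + (2 ^ n - set_encode B) = 2 ^ n - set_encode A"
    using set_encode_less[OF assms(3)] by simp
  ultimately show ?thesis by simp
qed

text \<open>Of the summands of \<open>v_n\<close> only the one ending in
  \<open>\<partial>_{n+2k}\<close> acts on this letter, and it leaves its coefficient.\<close>

lemma pivot_gen_even: "pivot n (gen (n + 2 * k)) = (monomial {n..<n + 2 * k} :: 'a::comm_ring_1 grassmann)"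
proof (induction k arbitrary: n)
  case 0
  then show ?case by (simp add: pivot_gen_self)
next
  case (Suc k)
  have "gen n * (gen (Suc n) * (monomial {n + 2..<n + 2 * Suc k} * 1)) =
      (monomial {n..<n + 2 * Suc k} * 1 :: 'a grassmann)"
    by (rule gen_gen_mult_monomial) auto
  then show ?case
    using Suc.IH[of "n + 2"] pivot_step[of n "gen (n + 2 * Suc k) :: 'a grassmann"]
    by (simp add: pderiv_gen)
qed

text \<open>Obtained from \<open>[v_n, v_n] = 2 x_{n+1} v_{n+2}\<close>, which carries no
  information in characteristic 2.\<close>

lemma top_letter_in_weight_component:
  assumes two_neq_0: "(2 :: 'k::field) \<noteq> 0"
  shows "(mult_pivot (gen (Suc n)) (Suc (Suc n)) :: 'k endo) \<in> weight_component (2 ^ Suc n)"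
proof -
  have "supercomm (pivot n) (pivot n) =
      (endo_scale 2 (mult_pivot (gen (Suc n)) (Suc (Suc n))) :: 'k endo)"
    using scale_add_left[of 1 "1 :: 'k"]
    by (simp add: fun_eq_iff supercomm_pivot pivot_square endo_apply(4) mult_pivot_def)
  moreover have "supercomm (pivot n) (pivot n :: 'k endo) \<in> weight_component (2 ^ n + 2 ^ n)"
    by (intro weight_component_supercomm pivot_in_weight_component)
  ultimately show ?thesis using weight_component_scaleD[OF _ two_neq_0] by (simp add: mult_2)
qed

text \<open>For even \<open>n \<ge> 2\<close> this is, up to sign, the bracket of \<open>v_0\<close>
  and \<open>v_{n-1}\<close>. For odd \<open>n \<ge> 3\<close> it is the bracket of
  \<open>v_0\<close> and \<open>x_{n-1} v_n\<close>, since \<open>v_0\<close> turns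
  \<open>x_{n-1}\<close> into \<open>x_0 ... x_{n-2}\<close>.\<close>

lemma full_monomial_in_weight_component:
  assumes two_neq_0: "(2 :: 'k::field) \<noteq> 0"
  shows "(mult_pivot (monomial {..<n - 1}) n :: 'k endo) \<in> weight_component (2 ^ n - set_encode {..<n - 1})"
proof (cases "n \<le> 1")
  \<comment> \<open>Truncated subtraction makes \<open>{..<n - 1}\<close> empty, leaving the pivot
    element itself.\<close>
  case True
  then show ?thesis using pivot_in_weight_component[of n] by (simp add: mult_pivot_one)
next
  case False
  have enc: "set_encode {..<m} + 1 = 2 ^ m" for m
    using set_encode_interval[of 0 m] by (simp add: atLeast0LessThan)
  have "(mult_pivot (monomial {..<n - 1}) n :: 'k endo) \<in> weight_component (2 ^ 0 + 2 ^ (n - 1))"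
  proof (cases "even n")
    case True
    then have "n = 2 * ((n - 2) div 2) + 2" using \<open>\<not> n \<le> 1\<close> by presburger
    then obtain k where k: "n = 2 * k + 2" by blast
    have "supercomm (pivot 0) (pivot (2 * k + 1)) =
        (endo_scale (- 1) (mult_pivot (monomial {..<n - 1}) n) :: 'k endo)"
      using pivot_anticommutator_odd[of 0 k, where 'a = 'k]
      by (simp add: k fun_eq_iff supercomm_pivot endo_apply(4) mult_pivot_def atLeast0LessThan)
    moreover have "supercomm (pivot 0) (pivot (2 * k + 1) :: 'k endo) \<in>
        weight_component (2 ^ 0 + 2 ^ (2 * k + 1))"
      by (intro weight_component_supercomm pivot_in_weight_component)
    ultimately show ?thesis using weight_component_scaleD[of "- 1 :: 'k"] k by simp
  next
    case odd: False
    then have "n = 2 * ((n - 3) div 2) + 3" using \<open>\<not> n \<le> 1\<close> by presburger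
    then obtain k where k: "n = 2 * k + 3" by blast
    have "supercomm (pivot 0) (mult_pivot (gen (2 * k + 2)) n) f =
        (mult_pivot (monomial {..<n - 1}) n f :: 'k grassmann)" for f
    proof -
      \<comment> \<open>The anticommutator of \<open>v_0\<close> and \<open>v_n\<close> already
        contains \<open>x_{n-1}\<close>, so multiplication by this letter kills the second-order
        term.\<close>
      have "gen (2 * k + 2) * monomial {0..<2 * k + 3} = (0 :: 'k grassmann)"
        using monomial_mult[of "{2 * k + 2}" "{0..<2 * k + 3}", where 'a = 'k]
        by (simp add: monomial_singleton)
      then have "gen (2 * k + 2) * (monomial {0..<2 * k + 3} * x) = (0 :: 'k grassmann)" for x
        by (metis mult.assoc mult_zero_left)
      then have "gen (2 * k + 2) * (pivot 0 (pivot n f) + pivot n (pivot 0 f)) = 0"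
        using pivot_anticommutator_odd[of 0 "k + 1" f] k by (simp add: numeral_3_eq_3)
      moreover have "pivot 0 (gen (2 * k + 2)) = (monomial {..<n - 1} :: 'k grassmann)"
        using pivot_gen_even[of 0 "k + 1", where 'a = 'k] k by (simp add: atLeast0LessThan)
      ultimately show ?thesis
        using supercomm_mult_pivot[OF part_one part_gen, of 0 "2 * k + 2" n f]
        by (simp add: mult_pivot_one pivot_one) (simp add: mult_pivot_def)
    qed
    then have "supercomm (pivot 0) (mult_pivot (gen (2 * k + 2)) n) =
        (mult_pivot (monomial {..<n - 1}) n :: 'k endo)"
      by (rule ext)
    moreover have "(mult_pivot (gen (2 * k + 2)) n :: 'k endo) \<in> weight_component (2 ^ (n - 1))"
      using top_letter_in_weight_component[OF two_neq_0, of "2 * k + 1"] k by (simp add: numeral_3_eq_3)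
    then have "supercomm (pivot 0) (mult_pivot (gen (2 * k + 2)) n :: 'k endo) \<in>
        weight_component (2 ^ 0 + 2 ^ (n - 1))"
      by (intro weight_component_supercomm pivot_in_weight_component)
    ultimately show ?thesis by simp
  qed
  moreover have "2 ^ n - set_encode {..<n - 1} = 2 ^ 0 + 2 ^ (n - 1)"
  proof -
    have "2 ^ n = 2 ^ (n - 1) + (2 ^ (n - 1) :: nat)" using False by (cases n) simp_all
    then show ?thesis using enc[of "n - 1"] by simp
  qed
  ultimately show ?thesis by simp
qed

text \<open>For even \<open>n\<close> this is half the bracket of \<open>v_0\<close> and
  \<open>v_{n-2}\<close>. For odd \<open>n \<ge> 5\<close> it comes from \<open>x_0 x_1 v_3\<close>
  and \<open>x_2 v_{n-2}\<close>: each pivot annihilates the letters of the other element, and the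
  anticommutator supplies the letters from \<open>x_3\<close> on. For \<open>n = 3\<close> it would
  be the excluded \<open>x_0 x_2 v_3\<close>.\<close>

lemma split_monomial_in_weight_component:
  assumes two_neq_0: "(2 :: 'k::field) \<noteq> 0" and n: "2 \<le> n" "n \<noteq> 3"
  shows "(mult_pivot (monomial (insert (n - 1) {..<n - 2})) n :: 'k endo) \<in>
    weight_component (2 ^ n - set_encode (insert (n - 1) {..<n - 2}))"
proof -
  have enc: "set_encode {..<m} + 1 = 2 ^ m" for m
    using set_encode_interval[of 0 m] by (simp add: atLeast0LessThan)
  obtain l where l: "n = l + 2" using n(1) by (metis add.commute le_Suc_ex)
  have "(mult_pivot (monomial (insert (n - 1) {..<n - 2})) n :: 'k endo) \<in> weight_component (2 ^ l + 1)"
  proof (cases "even n")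
    case True
    then have "l = 2 * (l div 2)" using l by presburger
    then obtain k where k: "l = 2 * k" by blast
    have "supercomm (pivot 0) (pivot (2 * k)) =
        (endo_scale 2 (mult_pivot (monomial (insert (n - 1) {..<n - 2})) n) :: 'k endo)"
      using pivot_anticommutator_even[of 0 k, where 'a = 'k]
      by (simp add: k l fun_eq_iff supercomm_pivot endo_apply(4) mult_pivot_def atLeast0LessThan)
    moreover have "supercomm (pivot 0) (pivot (2 * k) :: 'k endo) \<in>
        weight_component (2 ^ 0 + 2 ^ (2 * k))"
      by (intro weight_component_supercomm pivot_in_weight_component)
    ultimately show ?thesis using weight_component_scaleD[OF _ two_neq_0] k by simp
  next
    case False
    then have "l = 2 * ((l - 3) div 2) + 3" using l n(2) by presburger
    then obtain k where k: "l = 3 + 2 * k" by (metis add.commute)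
    let ?E = "insert (3 + 2 * k + 1) {3..<3 + 2 * k}"
    have "supercomm (mult_pivot (gen 0 * gen 1) 3) (mult_pivot (gen 2) l) f =
        (endo_scale (- 2) (mult_pivot (monomial (insert (n - 1) {..<n - 2})) n) f :: 'k grassmann)" for f
    proof -
      have "gen 2 * monomial ?E = (monomial (insert 2 ?E) :: 'k grassmann)"
        by (rule gen_mult_monomial) auto
      then have 1: "gen 2 * (monomial ?E * x) = (monomial (insert 2 ?E) * x :: 'k grassmann)" for x
        by (simp only: mult.assoc[symmetric])
      have "insert (n - 1) {..<n - 2} = insert 0 (insert (Suc 0) (insert 2 ?E))"
        by (auto simp: l k)
      then have 2: "gen 0 * (gen (Suc 0) * (monomial (insert 2 ?E) * x)) =
          (monomial (insert (n - 1) {..<n - 2}) * x :: 'k grassmann)" for x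
        by (intro gen_gen_mult_monomial) auto
      have part2: "part 2 (gen 0 * gen 1) = (gen 0 * gen 1 :: 'k grassmann)"
        using part_gen_mult[of 1 0 "gen 1 :: 'k grassmann"] by (simp add: numeral_2_eq_2)
      have "supercomm (mult_pivot (gen 0 * gen 1) 3) (mult_pivot (gen 2) l) f =
          - (gen 0 * (gen (Suc 0) * (gen 2 * (pivot 3 (pivot l f) + pivot l (pivot 3 f)))))"
        using supercomm_mult_pivot[OF part2 part_gen, of 3 2 l f] k
        by (simp add: pivot_gen_less pivot_gen_mult mult.assoc)
      also have "\<dots> = - scale 2 (gen 0 * (gen (Suc 0) * (gen 2 * (monomial ?E * pivot n f))))"
        using pivot_anticommutator_even[of 3 k f] by (simp add: k l scale_mult)
      also have "\<dots> = - scale 2 (monomial (insert (n - 1) {..<n - 2}) * pivot n f)"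
        unfolding 1 2 ..
      finally show ?thesis by (simp add: endo_apply(4) mult_pivot_def)
    qed
    then have eq: "supercomm (mult_pivot (gen 0 * gen 1) 3) (mult_pivot (gen 2) l) =
        (endo_scale (- 2) (mult_pivot (monomial (insert (n - 1) {..<n - 2})) n) :: 'k endo)"
      by (rule ext)
    have "gen 0 * gen 1 = (monomial {..<3 - 1} :: 'k grassmann)"
    proof -
      have "gen 0 * monomial {1} = (monomial (insert 0 {1}) :: 'k grassmann)"
        by (rule gen_mult_monomial) auto
      moreover have "insert 0 {1} = {..<3 - 1 :: nat}" by auto
      ultimately show ?thesis by (simp only: monomial_singleton)
    qed
    moreover have "2 ^ 3 - set_encode {..<3 - 1} = 5" using enc[of 2] by simp
    ultimately have a: "(mult_pivot (gen 0 * gen 1) 3 :: 'k endo) \<in> weight_component 5"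
      using full_monomial_in_weight_component[OF two_neq_0, of 3] by simp
    have b: "(mult_pivot (gen 2) l :: 'k endo) \<in> weight_component (2 ^ l - 4)"
    \<comment> \<open>For \<open>k = 0\<close>, that is \<open>l = 3\<close>, the full monomial
      \<open>x_0 x_1\<close> lacks the letter \<open>x_2\<close>, which is then the top
      letter.\<close>
    proof (cases "k = 0")
      case True
      then show ?thesis
        using top_letter_in_weight_component[OF two_neq_0, of 1] k
        by (simp add: numeral_3_eq_3 numeral_2_eq_2)
    next
      case False
      have "(mult_pivot (monomial {2}) l :: 'k endo) \<in> weight_component (2 ^ l - set_encode {2})"
        by (rule sub_monomial_in_weight_component[OF full_monomial_in_weight_component[OF two_neq_0]])
          (use k False in auto)
      then show ?thesis by (simp add: monomial_singleton)
    qed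
    have "5 + (2 ^ l - 4) = 2 ^ l + (1 :: nat)"
      using k by (simp add: power_add)
    then show ?thesis
      using weight_component_supercomm[OF a b] weight_component_scaleD[of "- 2 :: 'k"] two_neq_0
      unfolding eq by simp
  qed
  moreover have "2 ^ n - set_encode (insert (n - 1) {..<n - 2}) = 2 ^ l + 1"
  proof -
    have "set_encode (insert (n - 1) {..<n - 2}) = 2 ^ Suc l + set_encode {..<l}"
      by (simp add: l)
    then show ?thesis using enc[of l] by (simp add: l)
  qed
  ultimately show ?thesis by simp
qed

text \<open>For \<open>m \<ge> 2\<close> the bound \<open>2 ^ m < 4 * w\<close> says
  \<open>a < 3 * 2 ^ (m - 2)\<close>: the set with code \<open>a\<close> omits \<open>m - 1\<close>,
  or it contains \<open>m - 1\<close> and omits \<open>m - 2\<close>. Two kinds of maximal monomials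
  cover these cases.\<close>

lemma weight_elem_in_weight_component:
  assumes two_neq_0: "(2 :: 'k::field) \<noteq> 0" and m: "m \<in> weight_indices w"
  shows "(weight_elem w m :: 'k endo) \<in> weight_component w"
proof -
  define a where "a = 2 ^ m - w"
  have w: "w \<le> 2 ^ m" "2 ^ m < 4 * w" "(w, m) \<noteq> (1, 1)" "(w, m) \<noteq> (3, 3)"
    using m unfolding weight_indices_def by auto
  have a: "a + w = 2 ^ m" using w(1) by (simp add: a_def)
  have "(mult_pivot (monomial (set_decode a)) m :: 'k endo) \<in>
    weight_component (2 ^ m - set_encode (set_decode a))"
  proof (cases "a < 2 ^ (m - 1)")
    case True
    show ?thesis
      by (rule sub_monomial_in_weight_component[OF full_monomial_in_weight_component[OF two_neq_0]
            set_decode_subset[OF True]]) auto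
  next
    case False
    have "m \<noteq> 0"
    proof
      assume "m = 0"
      then show False using False a w(2) by simp
    qed
    moreover have "m \<noteq> 1"
    proof
      assume "m = 1"
      then show False using False a w(2,3) by simp
    qed
    ultimately obtain l where l: "m = l + 2" by (metis One_nat_def add_2_eq_Suc' not0_implies_Suc)
    obtain b where b: "a = 2 ^ (l + 1) + b" using False l by (metis add_2_eq_Suc' add_Suc_right
          diff_Suc_1 le_Suc_ex not_less Suc_eq_plus1)
    have "b < 2 ^ l" using a w(2) by (simp add: b l)
    then have sub: "set_decode b \<subseteq> {..<l}" by (rule set_decode_subset)
    have dec: "set_decode a = insert (l + 1) (set_decode b)"
    proof -
      have notin: "l + 1 \<notin> set_decode b"
      proof
        assume "l + 1 \<in> set_decode b"
        then have "l + 1 \<in> {..<l}" by (rule subsetD[OF sub])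
        then show False by simp
      qed
      have "set_encode (insert (l + 1) (set_decode b)) = a"
        unfolding set_encode_insert[OF finite_set_decode notin] b set_decode_inverse ..
      then show ?thesis using set_encode_inverse[of "insert (l + 1) (set_decode b)"]
        by (metis finite_insert finite_set_decode)
    qed
    show ?thesis
    proof (cases "m = 3")
      case True
      \<comment> \<open>The value \<open>b = 1\<close> would give the excluded
        \<open>x_0 x_2 v_3\<close>, so only the letter \<open>x_2\<close> remains.\<close>
      then have "b \<noteq> 1" using a w(4) l by (auto simp: b)
      then have "b = 0" using \<open>b < 2 ^ l\<close> True l by simp
      then have "set_decode a = {2}" using dec True l by simp
      then show ?thesis
        using top_letter_in_weight_component[OF two_neq_0, of 1] True
        by (simp add: monomial_singleton numeral_3_eq_3 numeral_2_eq_2)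
    next
      case False
      show ?thesis
        by (rule sub_monomial_in_weight_component[OF
              split_monomial_in_weight_component[OF two_neq_0 _ False]])
          (use sub in \<open>auto simp: l dec\<close>)
    qed
  qed
  moreover have "2 ^ m - set_encode (set_decode a) = w" using a by (simp add: set_decode_inverse)
  ultimately show ?thesis by (simp add: weight_elem_def a_def)
qed

lemma weight_component_basis:
  assumes "CHAR('k::field) \<noteq> 2"
  shows "(weight_component w :: 'k endo set) = endo.span (weight_elem w ` weight_indices w)"
proof
  have "(2 :: 'k) \<noteq> 0"
  proof
    assume "(2 :: 'k) = 0"
    then have "CHAR('k) dvd 2" using of_nat_eq_0_iff_char_dvd[of 2, where 'a = 'k] by simp
    moreover from this have "CHAR('k) \<le> 2" by (intro dvd_imp_le) simp_all
    moreover have "CHAR('k) \<noteq> Suc 0" by (rule CHAR_not_1)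
    ultimately show False using assms by (cases "CHAR('k) = 0") auto
  qed
  then show "endo.span (weight_elem w ` weight_indices w) \<subseteq> (weight_component w :: 'k endo set)"
    unfolding weight_component_eq
    by (intro endo.span_minimal endo.subspace_span)
      (auto simp: weight_component_eq[symmetric] intro: weight_elem_in_weight_component)
  have "lie_weight w \<subseteq> (endo.span (weight_elem w ` weight_indices w) :: 'k endo set)"
    using lie_element_in_span[OF _ assms] unfolding lie_weight_def by blast
  then show "(weight_component w :: 'k endo set) \<subseteq> endo.span (weight_elem w ` weight_indices w)"
    unfolding weight_component_eq by (rule endo.span_minimal) (rule endo.subspace_span)
qed

text \<open>By hypothesis \<open>2 ^ k\<close> is the least power of 2 not below \<open>n\<close>,
  so exactly \<open>2 ^ k\<close> and \<open>2 ^ (k + 1)\<close> lie between \<open>n\<close> and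
  \<open>4 * n - 1\<close>. For \<open>n = 1\<close> and \<open>n = 3\<close> the larger index is
  the excluded one.\<close>

lemma weight_indices_eq:
  assumes "n \<le> 2 ^ k" "2 ^ k < 2 * n"
  shows "weight_indices n = (if n = 1 \<or> n = 3 then {k} else {k, Suc k})"
proof -
  have "m = k \<or> m = Suc k" if "n \<le> 2 ^ m" "2 ^ m < 4 * n" for m
  proof (rule ccontr)
    assume "\<not> (m = k \<or> m = Suc k)"
    then consider "Suc m \<le> k" | "Suc (Suc k) \<le> m" by linarith
    then show False
    proof cases
      case 1
      then have "2 ^ Suc m \<le> (2 ^ k :: nat)" by (intro power_increasing) simp_all
      then show False using that assms by simp
    next
      case 2
      then have "2 ^ Suc (Suc k) \<le> (2 ^ m :: nat)" by (intro power_increasing) simp_all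
      then show False using that assms by simp
    qed
  qed
  then have *: "{m. n \<le> 2 ^ m \<and> 2 ^ m < 4 * n} = {k, Suc k}" using assms by auto
  have k1: "k = 0" if "n = 1" using assms that by (cases k) simp_all
  have k3: "k = 2" if "n = 3"
  proof -
    have "\<not> k \<le> 1"
    proof
      assume "k \<le> 1"
      then have "2 ^ k \<le> (2 ^ 1 :: nat)" by (intro power_increasing) simp_all
      then show False using assms that by simp
    qed
    moreover have "\<not> 3 \<le> k"
    proof
      assume "3 \<le> k"
      then have "2 ^ 3 \<le> (2 ^ k :: nat)" by (intro power_increasing) simp_all
      then show False using assms that by simp
    qed
    ultimately show ?thesis by simp
  qed
  have indices: "weight_indices n = {k, Suc k} - {m. (n, m) = (1, 1) \<or> (n, m) = (3, 3)}"
    unfolding *[symmetric] weight_indices_def by blast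
  consider "n = 1" | "n = 3" | "n \<noteq> 1" "n \<noteq> 3" by blast
  then show ?thesis
  proof cases
    case 1
    show ?thesis unfolding indices k1[OF 1] unfolding 1 by auto
  next
    case 2
    show ?thesis unfolding indices k3[OF 2] unfolding 2 by auto
  next
    case 3
    then show ?thesis unfolding indices by simp
  qed
qed

section \<open>Linear independence and dimension\<close>

lemma weight_elem_gen:
  "weight_elem w m (gen m) = monomial (set_decode (2 ^ m - w))"
  "weight_elem w (Suc m) (gen m) = 0"
  by (simp_all add: weight_elem_def mult_pivot_def pivot_gen_self pivot_gen_less)

lemma monomial_neq_0:
  assumes "finite A"
  shows "monomial A \<noteq> (0 :: 'k::comm_ring_1 grassmann)"
proof
  assume "monomial A = (0 :: 'k grassmann)"
  then have "coeff (monomial A :: 'k grassmann) A = coeff 0 A" by simp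
  then show False using assms by (simp add: coeff_monomial coeff_simps)
qed

lemma weight_elem_neq_0: "weight_elem w m \<noteq> (0 :: 'k::field endo)"
  using weight_elem_gen(1)[of w m, where 'a = 'k] monomial_neq_0[OF finite_set_decode, where 'k = 'k]
  by (metis endo_apply(3))

text \<open>Evaluation at \<open>x_k\<close> separates the two elements: \<open>v_k\<close> sends
  this letter to 1, while \<open>v_{k+1}\<close> annihilates it.\<close>

lemma independent_weight_elem:
  "endo.independent {weight_elem w k, weight_elem w (Suc k) :: 'k::field endo} \<and>
    weight_elem w k \<noteq> (weight_elem w (Suc k) :: 'k endo)"
proof -
  have "weight_elem w k \<notin> endo.span {weight_elem w (Suc k) :: 'k endo}"
  proof
    assume "weight_elem w k \<in> endo.span {weight_elem w (Suc k) :: 'k endo}"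
    then obtain c where "weight_elem w k = endo_scale c (weight_elem w (Suc k) :: 'k endo)"
      by (auto simp: endo.span_singleton)
    then have "weight_elem w k (gen k) = endo_scale c (weight_elem w (Suc k) :: 'k endo) (gen k)"
      by simp
    then show False
      using monomial_neq_0[OF finite_set_decode, where 'k = 'k]
      by (simp add: weight_elem_gen endo_apply(4))
  qed
  moreover from this have "weight_elem w k \<noteq> (weight_elem w (Suc k) :: 'k endo)"
    using endo.span_base[of "weight_elem w (Suc k) :: 'k endo" "{weight_elem w (Suc k)}"] by auto
  moreover have "endo.independent {weight_elem w (Suc k) :: 'k endo}"
    using endo.independent_insert[of "weight_elem w (Suc k) :: 'k endo" "{}"] weight_elem_neq_0[of w "Suc k"]
    by (simp add: endo.independent_empty endo.span_empty)
  ultimately show ?thesis by (simp add: endo.independent_insert)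
qed

lemma dim_weight_component:
  assumes "CHAR('k::field) \<noteq> 2" "1 \<le> n"
  shows "endo.dim (weight_component n :: 'k endo set) = (if n = 1 \<or> n = 3 then 1 else 2)"
proof -
  \<comment> \<open>Minimality gives \<open>2 ^ k < 2 * n\<close>, so that
    \<open>weight_indices_eq\<close> applies.\<close>
  define k where "k = (LEAST k. n \<le> 2 ^ k)"
  have "n \<le> 2 ^ n" by (rule less_imp_le) (rule less_exp)
  then have k: "n \<le> 2 ^ k" unfolding k_def by (rule LeastI)
  have "2 ^ k < 2 * n"
  proof (cases k)
    case 0
    then show ?thesis using assms(2) by simp
  next
    case (Suc j)
    then have "\<not> n \<le> 2 ^ j" using not_less_Least[of j "\<lambda>k. n \<le> 2 ^ k"] by (simp add: k_def)
    then show ?thesis using Suc by simp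
  qed
  note indices = weight_indices_eq[OF k this]
  have ind: "endo.independent (weight_elem n ` weight_indices n :: 'k endo set)"
    unfolding indices
    by (rule endo.independent_mono[OF conjunct1[OF independent_weight_elem[of n k]]]) auto
  have "endo.dim (weight_component n :: 'k endo set) = card (weight_elem n ` weight_indices n :: 'k endo set)"
    unfolding weight_component_basis[OF assms(1)]
    using endo.dim_span endo.dim_eq_card_independent[OF ind] by metis
  also have "\<dots> = (if n = 1 \<or> n = 3 then 1 else 2)"
    unfolding indices using independent_weight_elem[of n k, where 'k = 'k] by simp
  finally show ?thesis .
qed

theorem corollary8p3:
  shows "lie_gradation (pivot_lie :: 'k::field endo set) weight_component \<and>
    (CHAR('k) \<noteq> 2 \<longrightarrow>
      (\<forall>n\<ge>1. endo.dim (weight_component n :: 'k endo set) = (if n = 1 \<or> n = 3 then 1 else 2)))"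
  using lie_gradation_pivot_lie dim_weight_component by blast

end
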